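(* Let $L$ be a finite-dimensional solvable Lie algebra over a field $F$ with $L\in\mathcal{N}(n)$. Then $L$ is extreme if and only if there are nilpotent subalgebras $B_1,\ldots,B_n$ of $L$ such that, writing $U_0=L$ and $U_i=B_{i+1}+\cdots+B_n$ for $i=1,\ldots,n-1$, (i) $N_i(L)=B_1+\cdots +B_i$ for $i=1,\ldots, n$, (ii) $L=B_1+\cdots +B_n$, (iii) $[B_i,B_j]\subseteq B_i$ for $1\leq i\leq j\leq n$, (iv) $N_i(L)\cap U_i\subseteq \phi(U_i)=\phi_{i+1}(L)\cap U_i$ for $i=1,\ldots,n-1$, and moreover $\dim B_n=1$ and $N(U_k)/\phi(U_k)$ is a chief factor of $U_k$ for each $k=0,\ldots,n-1$.
   Context: $N(L)$ is the nilradical of $L$; the upper nilpotent series is $N_0(L)=0$, $N_i(L)/N_{i-1}(L)=N(L/N_{i-1}(L))$, and the nilpotent length $n(L)$ is the smallest integer $m$ with $N_m(L)=L$. $\mathcal{N}(n)$ is the class of Lie algebras of nilpotent length exactly $n$ ($n\ge 1$). The Frattini subalgebra $\phi(L)$ is the intersection of the maximal subalgebras of $L$ (an ideal, since $L$ is solvable), and $\phi_i(L)/N_{i-1}(L)=\phi(L/N_{i-1}(L))$ for $i=1,2,\ldots$. For ideals $B\subset A$ of $L$, $A/B$ is a chief factor of $L$ if it is a minimal ideal of $L/B$. $L$ is extreme if $N_i(L)/\phi_i(L)$ is a chief factor of $L$ for each $i=1,2,\ldots,n(L)$. *)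

theory Defs
  imports Complex_Main "HOL-Library.Set_Algebras"
begin

text \<open>
  The Lie algebra under study lives on a whole type, so that the linear algebra of
  \<^theory>\<open>HOL.Vector_Spaces\<close> applies to it.
\<close>

locale lie_algebra = vector_space scale
  for scale :: "'f::field \<Rightarrow> 'v::ab_group_add \<Rightarrow> 'v" +
  fixes bracket :: "'v \<Rightarrow> 'v \<Rightarrow> 'v"
  assumes bracket_add_left: "bracket (x + y) z = bracket x z + bracket y z"
    and bracket_add_right: "bracket x (y + z) = bracket x y + bracket x z"
    and bracket_scale_left: "bracket (scale c x) y = scale c (bracket x y)"
    and bracket_scale_right: "bracket x (scale c y) = scale c (bracket x y)"
    and bracket_self: "bracket x x = 0"
    and jacobi: "bracket x (bracket y z) + bracket y (bracket z x) + bracket z (bracket x y) = 0"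

text \<open>
  Subalgebras and quotients of it must again be treated as Lie algebras (one takes the
  nilradical and the Frattini subalgebra of both), and a quotient is not a type.
  The notions below are therefore defined for a carrier set with explicit operations.
  The record itself carries no axioms: it is used for the structures obtained from a
  \<open>lie_algebra\<close> by restricting the carrier to a subalgebra and by forming quotients by ideals.
\<close>

record ('f, 'v) lie_struct =
  lie_carrier :: "'v set"
  lie_zero :: 'v
  lie_add :: "'v \<Rightarrow> 'v \<Rightarrow> 'v"
  lie_smult :: "'f \<Rightarrow> 'v \<Rightarrow> 'v"
  lie_bracket :: "'v \<Rightarrow> 'v \<Rightarrow> 'v"

definition lie_of ::
    "('f \<Rightarrow> 'v \<Rightarrow> 'v) \<Rightarrow> ('v \<Rightarrow> 'v \<Rightarrow> 'v) \<Rightarrow> ('f, 'v::ab_group_add) lie_struct" where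
  "lie_of scale bracket =
     \<lparr>lie_carrier = UNIV, lie_zero = 0, lie_add = (+), lie_smult = scale, lie_bracket = bracket\<rparr>"

definition lie_restrict :: "('f, 'v) lie_struct \<Rightarrow> 'v set \<Rightarrow> ('f, 'v) lie_struct" where
  "lie_restrict L U = L\<lparr>lie_carrier := U\<rparr>"

definition lie_subspace :: "('f, 'v) lie_struct \<Rightarrow> 'v set \<Rightarrow> bool" where
  "lie_subspace L S \<longleftrightarrow> S \<subseteq> lie_carrier L \<and> lie_zero L \<in> S \<and>
     (\<forall>x\<in>S. \<forall>y\<in>S. lie_add L x y \<in> S) \<and> (\<forall>c. \<forall>x\<in>S. lie_smult L c x \<in> S)"

definition lie_subalgebra :: "('f, 'v) lie_struct \<Rightarrow> 'v set \<Rightarrow> bool" where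
  "lie_subalgebra L S \<longleftrightarrow> lie_subspace L S \<and> (\<forall>x\<in>S. \<forall>y\<in>S. lie_bracket L x y \<in> S)"

definition lie_ideal :: "('f, 'v) lie_struct \<Rightarrow> 'v set \<Rightarrow> bool" where
  "lie_ideal L I \<longleftrightarrow> lie_subspace L I \<and> (\<forall>x\<in>lie_carrier L. \<forall>y\<in>I. lie_bracket L x y \<in> I)"

definition lie_span :: "('f, 'v) lie_struct \<Rightarrow> 'v set \<Rightarrow> 'v set" where
  "lie_span L S = \<Inter>{W. lie_subspace L W \<and> S \<subseteq> W}"

text \<open>The product \<open>[A, B]\<close> is the subspace spanned by the brackets, not the set of brackets.\<close>

definition lie_prod :: "('f, 'v) lie_struct \<Rightarrow> 'v set \<Rightarrow> 'v set \<Rightarrow> 'v set" where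
  "lie_prod L A B = lie_span L {lie_bracket L a b | a b. a \<in> A \<and> b \<in> B}"

primrec lower_central :: "('f, 'v) lie_struct \<Rightarrow> nat \<Rightarrow> 'v set" where
  "lower_central L 0 = lie_carrier L"
| "lower_central L (Suc k) = lie_prod L (lie_carrier L) (lower_central L k)"

primrec derived_series :: "('f, 'v) lie_struct \<Rightarrow> nat \<Rightarrow> 'v set" where
  "derived_series L 0 = lie_carrier L"
| "derived_series L (Suc k) = lie_prod L (derived_series L k) (derived_series L k)"

definition lie_nilpotent :: "('f, 'v) lie_struct \<Rightarrow> bool" where
  "lie_nilpotent L \<longleftrightarrow> (\<exists>k. lower_central L k = {lie_zero L})"

definition lie_solvable :: "('f, 'v) lie_struct \<Rightarrow> bool" where
  "lie_solvable L \<longleftrightarrow> (\<exists>k. derived_series L k = {lie_zero L})"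

text \<open>
  The nilradical is the sum of all nilpotent ideals; in finite dimension it is the largest
  nilpotent ideal.
\<close>

definition nilradical :: "('f, 'v) lie_struct \<Rightarrow> 'v set" where
  "nilradical L = lie_span L (\<Union>{I. lie_ideal L I \<and> lie_nilpotent (lie_restrict L I)})"

definition maximal_subalgebra :: "('f, 'v) lie_struct \<Rightarrow> 'v set \<Rightarrow> bool" where
  "maximal_subalgebra L M \<longleftrightarrow> lie_subalgebra L M \<and> M \<noteq> lie_carrier L \<and>
     (\<forall>S. lie_subalgebra L S \<and> M \<subseteq> S \<longrightarrow> S = M \<or> S = lie_carrier L)"

text \<open>The zero algebra has no maximal subalgebra and is its own Frattini subalgebra.\<close>

definition frattini :: "('f, 'v) lie_struct \<Rightarrow> 'v set" where
  "frattini L = lie_carrier L \<inter> \<Inter>{M. maximal_subalgebra L M}"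

definition lie_coset :: "('f, 'v) lie_struct \<Rightarrow> 'v set \<Rightarrow> 'v \<Rightarrow> 'v set" where
  "lie_coset L I x = lie_add L x ` I"

text \<open>
  The operations on cosets are given without choosing representatives, as unions over all
  of them; see the lemma \<open>lie_quot_coset\<close>.
\<close>

definition lie_quot :: "('f, 'v) lie_struct \<Rightarrow> 'v set \<Rightarrow> ('f, 'v set) lie_struct" where
  "lie_quot L I =
     \<lparr>lie_carrier = lie_coset L I ` lie_carrier L,
      lie_zero = I,
      lie_add = (\<lambda>X Y. \<Union>x\<in>X. \<Union>y\<in>Y. lie_coset L I (lie_add L x y)),
      lie_smult = (\<lambda>c X. \<Union>x\<in>X. lie_coset L I (lie_smult L c x)),
      lie_bracket = (\<lambda>X Y. \<Union>x\<in>X. \<Union>y\<in>Y. lie_coset L I (lie_bracket L x y))\<rparr>"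

definition minimal_ideal :: "('f, 'v) lie_struct \<Rightarrow> 'v set \<Rightarrow> bool" where
  "minimal_ideal L A \<longleftrightarrow> lie_ideal L A \<and> A \<noteq> {lie_zero L} \<and>
     (\<forall>J. lie_ideal L J \<and> J \<subseteq> A \<longrightarrow> J = {lie_zero L} \<or> J = A)"

definition chief_factor :: "('f, 'v) lie_struct \<Rightarrow> 'v set \<Rightarrow> 'v set \<Rightarrow> bool" where
  "chief_factor L A B \<longleftrightarrow> lie_ideal L A \<and> lie_ideal L B \<and> B \<subset> A \<and>
     minimal_ideal (lie_quot L B) (lie_coset L B ` A)"

text \<open>
  \<open>N_i(L)\<close> and \<open>\<phi>_i(L)\<close> are the full preimages in \<open>L\<close> of the nilradical and of the Frattini
  subalgebra of \<open>L/N_{i-1}(L)\<close>; \<open>\<phi>_i(L)\<close> is only meaningful for \<open>i \<ge> 1\<close>.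
\<close>

primrec upper_nil :: "('f, 'v) lie_struct \<Rightarrow> nat \<Rightarrow> 'v set" where
  "upper_nil L 0 = {lie_zero L}"
| "upper_nil L (Suc i) = {x \<in> lie_carrier L.
     lie_coset L (upper_nil L i) x \<in> nilradical (lie_quot L (upper_nil L i))}"

definition upper_frattini :: "('f, 'v) lie_struct \<Rightarrow> nat \<Rightarrow> 'v set" where
  "upper_frattini L i = {x \<in> lie_carrier L.
     lie_coset L (upper_nil L (i - 1)) x \<in> frattini (lie_quot L (upper_nil L (i - 1)))}"

definition nilpotent_length :: "('f, 'v) lie_struct \<Rightarrow> nat" where
  "nilpotent_length L = (LEAST m. upper_nil L m = lie_carrier L)"

definition nilpotent_length_class :: "nat \<Rightarrow> ('f, 'v) lie_struct set" where
  "nilpotent_length_class n =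
     {L. 1 \<le> n \<and> (\<exists>m. upper_nil L m = lie_carrier L) \<and> nilpotent_length L = n}"

definition extreme :: "('f, 'v) lie_struct \<Rightarrow> bool" where
  "extreme L \<longleftrightarrow>
     (\<forall>i\<in>{1..nilpotent_length L}. chief_factor L (upper_nil L i) (upper_frattini L i))"

text \<open>
  For \<open>B_1, \<dots>, B_n\<close>: \<open>U_0\<close> is the whole algebra, and \<open>U_k = B_{k+1} + \<dots> + B_n\<close> for
  \<open>1 \<le> k < n\<close> (sums of sets from \<^theory>\<open>HOL-Library.Set_Algebras\<close>).
\<close>

definition tail_sum :: "nat \<Rightarrow> (nat \<Rightarrow> 'v::ab_group_add set) \<Rightarrow> nat \<Rightarrow> 'v set" where
  "tail_sum n B k = (if k = 0 then UNIV else (\<Sum>j\<in>{k+1..n}. B j))"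

text \<open>The quotient operations act on representatives in the usual way.\<close>

lemma (in lie_algebra) lie_quot_coset:
  defines "L \<equiv> lie_of scale bracket"
  assumes I: "lie_ideal (lie_restrict L U) I" and x: "x \<in> U" and y: "y \<in> U"
  defines "K \<equiv> lie_restrict L U"
  shows "lie_zero (lie_quot K I) = lie_coset K I 0"
    and "lie_add (lie_quot K I) (lie_coset K I x) (lie_coset K I y) = lie_coset K I (x + y)"
    and "lie_smult (lie_quot K I) c (lie_coset K I x) = lie_coset K I (scale c x)"
    and "lie_bracket (lie_quot K I) (lie_coset K I x) (lie_coset K I y)
           = lie_coset K I (bracket x y)"
proof -
  note ops = K_def L_def lie_restrict_def lie_of_def
  have I0: "0 \<in> I" and Iadd: "\<And>a b. a \<in> I \<Longrightarrow> b \<in> I \<Longrightarrow> a + b \<in> I"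
    and Iscale: "\<And>c a. a \<in> I \<Longrightarrow> scale c a \<in> I" and IU: "I \<subseteq> U"
    and Ibr: "\<And>u a. u \<in> U \<Longrightarrow> a \<in> I \<Longrightarrow> bracket u a \<in> I"
    using I by (auto simp: ops lie_ideal_def lie_subspace_def)
  have Ineg: "- a \<in> I" if "a \<in> I" for a
    using Iscale[OF that, of "- 1"] by simp
  have skew: "bracket a b = - bracket b a" for a b
  proof -
    have "bracket (a + b) (a + b) = bracket a b + bracket b a"
      by (simp only: bracket_add_left bracket_add_right) (simp add: bracket_self add.commute)
    then show ?thesis by (simp add: bracket_self eq_neg_iff_add_eq_0)
  qed
  have coset: "lie_coset K I a = (+) a ` I" for a
    by (simp add: lie_coset_def ops)
  have eq: "lie_coset K I (w + a) = lie_coset K I w" if "a \<in> I" for w a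
  proof -
    have "z \<in> (+) (w + a) ` I" if z: "z \<in> (+) w ` I" for z
    proof -
      obtain b where b: "b \<in> I" "z = w + b" using z by auto
      then have "z = (w + a) + (b + - a)" by simp
      then show ?thesis using b(1) Iadd Ineg \<open>a \<in> I\<close> by blast
    qed
    moreover have "z \<in> (+) w ` I" if "z \<in> (+) (w + a) ` I" for z
      using that Iadd \<open>a \<in> I\<close> by (auto simp: add.assoc)
    ultimately show ?thesis unfolding coset by blast
  qed
  have ne: "I \<noteq> {}" using I0 by blast
  show "lie_zero (lie_quot K I) = lie_coset K I 0"
    by (simp add: coset lie_quot_def)
  have "lie_coset K I ((x + a) + (y + b)) = lie_coset K I (x + y)" if "a \<in> I" "b \<in> I" for a b
    using eq[of "a + b" "x + y"] Iadd that by (simp add: ac_simps)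
  then show "lie_add (lie_quot K I) (lie_coset K I x) (lie_coset K I y) = lie_coset K I (x + y)"
    using ne by (simp add: lie_quot_def coset[of x] coset[of y]) (simp add: ops)
  have "lie_coset K I (scale c (x + a)) = lie_coset K I (scale c x)" if "a \<in> I" for a
    using eq[of "scale c a" "scale c x"] Iscale that by (simp add: scale_right_distrib)
  then show "lie_smult (lie_quot K I) c (lie_coset K I x) = lie_coset K I (scale c x)"
    using ne by (simp add: lie_quot_def coset[of x]) (simp add: ops)
  have "lie_coset K I (bracket (x + a) (y + b)) = lie_coset K I (bracket x y)"
    if "a \<in> I" "b \<in> I" for a b
  proof -
    have "bracket (x + a) (y + b) =
        bracket x y + (bracket x b + (- bracket y a + bracket a b))"
      by (simp add: bracket_add_left bracket_add_right skew[of a y] algebra_simps)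
    moreover have "bracket x b + (- bracket y a + bracket a b) \<in> I"
      using that x y IU by (intro Iadd Ineg Ibr) auto
    ultimately show ?thesis by (simp only: eq)
  qed
  then show "lie_bracket (lie_quot K I) (lie_coset K I x) (lie_coset K I y)
      = lie_coset K I (bracket x y)"
    using ne by (simp add: lie_quot_def coset[of x] coset[of y]) (simp add: ops)
qed

end

(*
  If S is a subalgebra with L = N + S, N an ideal and N \<inter> S \<subseteq> \<phi>(S), then L/N and S/(N \<inter> S) are
  isomorphic, and N(S/(N \<inter> S)) = N(S)/(N \<inter> S) because N \<inter> S lies in the Frattini subalgebra. Hence for
  N = N_k(L) the pairs N(S), \<phi>(S) and N_{k+1}(L), \<phi>_{k+1}(L) correspond to each other, and
  N(S)/\<phi>(S) is a chief factor of S iff N_{k+1}(L)/\<phi>_{k+1}(L) is one of L.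

  For S = U_k this shows that a decomposition makes L extreme. Conversely, start from U_0 = L, let
  U_{k+1} be a minimal supplement of N(U_k) in U_k, and put B_{k+1} = N(U_k). Minimality gives
  N(U_k) \<inter> U_{k+1} \<subseteq> \<phi>(U_{k+1}). Finally B_n = U_{n-1} is nilpotent with a chief Frattini quotient,
  which forces dimension one.
*)
theory Submission
  imports Defs
begin

text \<open>A quotient lives on another type, while nilradicals and Frattini subalgebras are needed
  for quotients and for the subalgebras \<open>U_k\<close> alike. All notions are therefore recast
  as subsets of one type relative to a kernel \<open>K\<close>, and each is shown once to be a
  preimage along an arbitrary surjection. The two halves of the transfer are not equally deep. A
  maximal subalgebra contains whatever lies in the Frattini subalgebra, so that half is immediate.
  That factoring out such an ideal does not enlarge the nilradical needs Fitting null components and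
  an Engel argument; solvability supplies the derived series on which the latter runs. It is not
  established beforehand that Frattini subalgebras are ideals. The property travels as a part of
  \<open>chief\<close>, and carrying it from a supplement up to L takes an argument of its
  own.\<close>

context lie_algebra
begin

section \<open>Subalgebras, ideals and series as plain sets\<close>

definition subalg :: "'v set \<Rightarrow> bool" where
  "subalg U \<longleftrightarrow> subspace U \<and> (\<forall>x\<in>U. \<forall>y\<in>U. bracket x y \<in> U)"

definition ideal_in :: "'v set \<Rightarrow> 'v set \<Rightarrow> bool" where
  "ideal_in U I \<longleftrightarrow> subspace I \<and> I \<subseteq> U \<and> (\<forall>x\<in>U. \<forall>y\<in>I. bracket x y \<in> I)"

definition br :: "'v set \<Rightarrow> 'v set \<Rightarrow> 'v set" where
  "br A B = span {bracket a b | a b. a \<in> A \<and> b \<in> B}"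

primrec lower :: "'v set \<Rightarrow> nat \<Rightarrow> 'v set" where
  "lower J 0 = J"
| "lower J (Suc k) = br J (lower J k)"

primrec derived :: "'v set \<Rightarrow> nat \<Rightarrow> 'v set" where
  "derived J 0 = J"
| "derived J (Suc k) = br (derived J k) (derived J k)"

text \<open>For an ideal \<open>K\<close> this is nilpotency of the image of \<open>J\<close> modulo
  \<open>K\<close>. \<open>K\<close> need not lie in \<open>J\<close>, so one kernel serves all
  subalgebras.\<close>

definition nil_mod :: "'v set \<Rightarrow> 'v set \<Rightarrow> bool" where
  "nil_mod J K \<longleftrightarrow> (\<exists>k. lower J k \<subseteq> K)"

text \<open>The full preimages in \<open>U\<close> of the nilradical and of the Frattini subalgebra of \<open>U/K\<close>;
  for \<open>K = {0}\<close> they are those of \<open>U\<close> itself.\<close>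

definition nilrad_mod :: "'v set \<Rightarrow> 'v set \<Rightarrow> 'v set" where
  "nilrad_mod U K = span (\<Union>{J. ideal_in U J \<and> K \<subseteq> J \<and> nil_mod J K})"

definition max_subalg :: "'v set \<Rightarrow> 'v set \<Rightarrow> bool" where
  "max_subalg U M \<longleftrightarrow> subalg M \<and> M \<subset> U \<and> (\<forall>S. subalg S \<and> M \<subseteq> S \<and> S \<subseteq> U \<longrightarrow> S = M \<or> S = U)"

definition frat_mod :: "'v set \<Rightarrow> 'v set \<Rightarrow> 'v set" where
  "frat_mod U K = U \<inter> \<Inter>{M. max_subalg U M \<and> K \<subseteq> M}"

text \<open>The correspondence theorem turns a minimal ideal of U/B into a pair of neighbouring
  ideals of \<open>U\<close>, so that no quotient appears.\<close>

definition chief :: "'v set \<Rightarrow> 'v set \<Rightarrow> 'v set \<Rightarrow> bool" where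
  "chief U A B \<longleftrightarrow> ideal_in U A \<and> ideal_in U B \<and> B \<subset> A \<and>
     (\<forall>J. ideal_in U J \<and> B \<subseteq> J \<and> J \<subseteq> A \<longrightarrow> J = B \<or> J = A)"

lemma subalgD: "subalg U \<Longrightarrow> subspace U" "subalg U \<Longrightarrow> x \<in> U \<Longrightarrow> y \<in> U \<Longrightarrow> bracket x y \<in> U"
  by (auto simp: subalg_def)

lemma idealD: "ideal_in U I \<Longrightarrow> subspace I" "ideal_in U I \<Longrightarrow> I \<subseteq> U"
    "ideal_in U I \<Longrightarrow> x \<in> U \<Longrightarrow> y \<in> I \<Longrightarrow> bracket x y \<in> I"
  by (auto simp: ideal_in_def)

lemma bracket_skew: "bracket a b = - bracket b a"
proof -
  have "bracket (a + b) (a + b) = bracket a b + bracket b a"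
    by (simp only: bracket_add_left bracket_add_right) (simp add: bracket_self add.commute)
  then show ?thesis by (simp add: bracket_self eq_neg_iff_add_eq_0)
qed

lemma bracket_zero [simp]: "bracket 0 x = 0" "bracket x 0 = 0"
  using bracket_add_left[of 0 0 x] bracket_add_right[of x 0 0] by auto

lemma bracket_minus: "bracket (- x) y = - bracket x y" "bracket x (- y) = - bracket x y"
  using bracket_scale_left[of "-1" x y] bracket_scale_right[of x "-1" y] by auto

text \<open>Jacobi in the form that is used below: \<open>bracket x\<close> is a derivation.\<close>

lemma leibniz: "bracket x (bracket y z) = bracket (bracket x y) z + bracket y (bracket x z)"
proof -
  have "bracket y (bracket z x) = - bracket y (bracket x z)" "bracket z (bracket x y) = - bracket (bracket x y) z"
    by (metis bracket_skew bracket_minus(2)) (rule bracket_skew)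
  then show ?thesis using jacobi[of x y z] by (simp add: algebra_simps)
qed

lemma idealD': "ideal_in U I \<Longrightarrow> x \<in> U \<Longrightarrow> y \<in> I \<Longrightarrow> bracket y x \<in> I"
  by (metis bracket_skew idealD(1,3) subspace_neg)

lemma ideal_subalg: "ideal_in U I \<Longrightarrow> subalg I"
  unfolding subalg_def using idealD by blast

lemma ideal_self: "subalg U \<Longrightarrow> ideal_in U U"
  by (auto simp: subalg_def ideal_in_def)

lemma ideal_zero: "subalg U \<Longrightarrow> ideal_in U {0}"
  by (auto simp: subalg_def ideal_in_def subspace_0)

lemma subalg_UNIV: "subalg UNIV"
  by (simp add: subalg_def)

lemma ideal_Int: "ideal_in U I \<Longrightarrow> subalg S \<Longrightarrow> S \<subseteq> U \<Longrightarrow> ideal_in S (I \<inter> S)"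
  by (auto simp: ideal_in_def subalg_def subspace_inter)

lemma subspace_plus: "subspace A \<Longrightarrow> subspace B \<Longrightarrow> subspace (A + B)"
proof -
  have "A + B = {x + y |x y. x \<in> A \<and> y \<in> B}" by (auto simp: set_plus_def)
  then show "subspace A \<Longrightarrow> subspace B \<Longrightarrow> subspace (A + B)" using subspace_sums by simp
qed

lemma plus_absorb: "subspace A \<Longrightarrow> C \<subseteq> A \<Longrightarrow> D \<subseteq> A \<Longrightarrow> C + D \<subseteq> A"
  by (auto simp: set_plus_def subset_iff subspace_add)

lemma subset_plus: "subspace A \<Longrightarrow> B \<subseteq> A + B" "subspace B \<Longrightarrow> A \<subseteq> A + B"
  by (metis subspace_0 set_zero_plus2) (metis add.commute subspace_0 set_zero_plus2)

lemma ideal_plus: "ideal_in U A \<Longrightarrow> ideal_in U B \<Longrightarrow> ideal_in U (A + B)" if "subalg U"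
  using that plus_absorb[of U A B]
  by (auto simp: ideal_in_def subalg_def subspace_plus bracket_add_right set_plus_intro elim!: set_plus_elim)

lemma brI: "a \<in> A \<Longrightarrow> b \<in> B \<Longrightarrow> bracket a b \<in> br A B"
  unfolding br_def by (rule span_base) blast

lemma subspace_br: "subspace (br A B)"
  by (simp add: br_def)

lemma br_subset: "subspace W \<Longrightarrow> (\<And>a b. a \<in> A \<Longrightarrow> b \<in> B \<Longrightarrow> bracket a b \<in> W) \<Longrightarrow> br A B \<subseteq> W"
  unfolding br_def by (rule span_minimal) auto

lemma br_mono: "A \<subseteq> A' \<Longrightarrow> B \<subseteq> B' \<Longrightarrow> br A B \<subseteq> br A' B'"
  by (intro br_subset subspace_br brI) auto

lemma ideal_span:
  assumes "\<And>u x. u \<in> U \<Longrightarrow> x \<in> X \<Longrightarrow> bracket u x \<in> span X" "X \<subseteq> U" "subspace U"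
  shows "ideal_in U (span X)"
proof -
  have "bracket u y \<in> span X" if u: "u \<in> U" and y: "y \<in> span X" for u y
  proof -
    have "subspace {y. bracket u y \<in> span X}"
      by (auto simp: subspace_def bracket_add_right bracket_scale_right span_add span_scale span_zero)
    moreover have "X \<subseteq> {y. bracket u y \<in> span X}" using assms(1) u by auto
    ultimately show ?thesis using span_minimal y by blast
  qed
  then show ?thesis using assms span_minimal by (auto simp: ideal_in_def)
qed

lemma ideal_br:
  assumes "subspace U" "ideal_in U A" "ideal_in U B"
  shows "ideal_in U (br A B)"
  unfolding br_def
proof (rule ideal_span)
  fix u x assume u: "u \<in> U" and "x \<in> {bracket a b |a b. a \<in> A \<and> b \<in> B}"
  then obtain a b where ab: "a \<in> A" "b \<in> B" "x = bracket a b" by blast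
  have "bracket u x = bracket (bracket u a) b + bracket a (bracket u b)"
    by (simp add: ab leibniz[of u])
  also have "\<dots> \<in> br A B"
    using ab u assms idealD by (intro subspace_add[OF subspace_br] brI) blast+
  finally show "bracket u x \<in> span {bracket a b |a b. a \<in> A \<and> b \<in> B}" by (simp add: br_def)
qed (use assms in \<open>auto simp: ideal_in_def subset_iff\<close>)

lemma lower_subset: "subalg J \<Longrightarrow> lower J k \<subseteq> J"
proof (induction k)
  case (Suc k)
  then show ?case by (simp, intro br_subset) (auto simp: subalg_def)
qed simp

lemma subspace_lower: "subspace J \<Longrightarrow> subspace (lower J k)"
  by (cases k) (simp_all add: subspace_br)

lemma derived_subset: "subalg U \<Longrightarrow> derived U k \<subseteq> U"
proof (induction k)
  case (Suc k)
  then show ?case by (simp, intro br_subset) (auto simp: subalg_def)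
qed simp

lemma nilrad_ideal:
  assumes "subalg U" shows "ideal_in U (nilrad_mod U K)"
  unfolding nilrad_mod_def
proof (rule ideal_span)
  fix u x assume "u \<in> U" "x \<in> \<Union>{J. ideal_in U J \<and> K \<subseteq> J \<and> nil_mod J K}"
  then have "bracket u x \<in> \<Union>{J. ideal_in U J \<and> K \<subseteq> J \<and> nil_mod J K}"
    using idealD(3) by blast
  then show "bracket u x \<in> span (\<Union>{J. ideal_in U J \<and> K \<subseteq> J \<and> nil_mod J K})"
    by (rule span_base)
qed (use assms in \<open>auto simp: subalg_def ideal_in_def\<close>)

lemma nilrad_upper:
  "ideal_in U J \<Longrightarrow> K \<subseteq> J \<Longrightarrow> nil_mod J K \<Longrightarrow> J \<subseteq> nilrad_mod U K"
  unfolding nilrad_mod_def by (rule order_trans[OF _ span_superset]) blast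

lemma nilrad_contains: "ideal_in U K \<Longrightarrow> K \<subseteq> nilrad_mod U K"
  by (rule nilrad_upper) (auto simp: nil_mod_def intro: exI[of _ 0])

lemma subspace_frat: "subalg U \<Longrightarrow> subspace (frat_mod U K)"
  by (auto simp: frat_mod_def max_subalg_def subalg_def subspace_def)

lemma frat_contains: "K \<subseteq> U \<Longrightarrow> K \<subseteq> frat_mod U K"
  by (auto simp: frat_mod_def)

subsection \<open>Transport along surjective homomorphisms\<close>

text \<open>\<open>Q\<close> has no axioms of its own; the surjection from a subalgebra supplies
  them. The cases in mind are the identity, coset maps, and restrictions of these.\<close>

definition onto_hom :: "'v set \<Rightarrow> ('f, 'w) lie_struct \<Rightarrow> ('v \<Rightarrow> 'w) \<Rightarrow> bool" where
  "onto_hom U Q h \<longleftrightarrow> subalg U \<and> lie_carrier Q = h ` U \<and> lie_zero Q = h 0 \<and>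
     (\<forall>x\<in>U. \<forall>y\<in>U. lie_add Q (h x) (h y) = h (x + y) \<and> lie_bracket Q (h x) (h y) = h (bracket x y)) \<and>
     (\<forall>c. \<forall>x\<in>U. lie_smult Q c (h x) = h (scale c x))"

definition pull :: "'v set \<Rightarrow> ('v \<Rightarrow> 'w) \<Rightarrow> 'w set \<Rightarrow> 'v set" where
  "pull U h S = {x \<in> U. h x \<in> S}"

definition hom_ker :: "'v set \<Rightarrow> ('v \<Rightarrow> 'w) \<Rightarrow> 'v set" where
  "hom_ker U h = {x \<in> U. h x = h 0}"

lemma onto_hom_restrict:
  assumes "onto_hom U Q h" "subalg S" "S \<subseteq> U"
  shows "onto_hom S (lie_restrict Q (h ` S)) h"
  using assms by (auto simp: onto_hom_def lie_restrict_def subset_iff)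

lemma onto_hom_sub:
  assumes "onto_hom U Q h" "subalg S" "S \<subseteq> U" "h ` S = h ` U"
  shows "onto_hom S Q h"
  using assms by (auto simp: onto_hom_def subset_iff)

context
  fixes U and Q :: "('f, 'w) lie_struct" and h
  assumes hom: "onto_hom U Q h"
begin

lemma hom_subalg: "subalg U" and hom_carrier: "lie_carrier Q = h ` U" and hom_zero: "lie_zero Q = h 0"
    and hom_add: "x \<in> U \<Longrightarrow> y \<in> U \<Longrightarrow> lie_add Q (h x) (h y) = h (x + y)"
    and hom_bracket: "x \<in> U \<Longrightarrow> y \<in> U \<Longrightarrow> lie_bracket Q (h x) (h y) = h (bracket x y)"
    and hom_smult: "x \<in> U \<Longrightarrow> lie_smult Q c (h x) = h (scale c x)"
  using hom by (auto simp: onto_hom_def)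

lemma image_subspace: "subspace P \<Longrightarrow> P \<subseteq> U \<Longrightarrow> lie_subspace Q (h ` P)"
  unfolding lie_subspace_def hom_carrier hom_zero
  by (auto simp: subset_iff hom_add hom_smult subspace_add subspace_scale subspace_0 intro!: imageI)

lemma image_ideal: "ideal_in U P \<Longrightarrow> lie_ideal Q (h ` P)"
  unfolding lie_ideal_def hom_carrier ideal_in_def
  by (auto simp: image_subspace subset_iff hom_bracket)

lemma image_subalg: "subalg P \<Longrightarrow> P \<subseteq> U \<Longrightarrow> lie_subalgebra Q (h ` P)"
  unfolding lie_subalgebra_def
  by (auto simp: image_subspace subalgD subset_iff hom_bracket intro!: imageI)

lemma pull_subspace: "lie_subspace Q S \<Longrightarrow> subspace (pull U h S)"
  using subalgD(1)[OF hom_subalg] unfolding lie_subspace_def hom_zero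
  by (auto simp: subspace_def pull_def simp flip: hom_add hom_smult)

lemma pull_ideal: "lie_ideal Q S \<Longrightarrow> ideal_in U (pull U h S)"
  using hom_subalg unfolding ideal_in_def lie_ideal_def hom_carrier
  by (auto simp: pull_subspace subalgD) (auto simp: pull_def subalgD simp flip: hom_bracket)

lemma pull_subalg: "lie_subalgebra Q S \<Longrightarrow> subalg (pull U h S)"
  using hom_subalg unfolding subalg_def[of "pull U h S"] lie_subalgebra_def
  by (auto simp: pull_subspace) (auto simp: pull_def subalgD simp flip: hom_bracket)

lemma ker_subset_pull: "lie_subspace Q S \<Longrightarrow> hom_ker U h \<subseteq> pull U h S"
  by (auto simp: lie_subspace_def hom_ker_def pull_def hom_zero)

lemma image_pull: "lie_subspace Q S \<Longrightarrow> h ` pull U h S = S"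
  by (auto simp: lie_subspace_def pull_def hom_carrier)

lemma pull_image:
  assumes P: "subspace P" "P \<subseteq> U" "hom_ker U h \<subseteq> P"
  shows "pull U h (h ` P) = P"
proof
  show "pull U h (h ` P) \<subseteq> P"
  proof
    fix x assume "x \<in> pull U h (h ` P)"
    then obtain p where p: "x \<in> U" "p \<in> P" "h x = h p" by (auto simp: pull_def)
    have pU: "p \<in> U" "scale (-1) p \<in> U"
      using p P hom_subalg subalgD(1) subspace_scale by blast+
    \<comment> \<open>\<open>Q\<close> offers no subtraction, so the difference is formed in
      \<open>U\<close> and passed through \<open>hom_add\<close>.\<close>
    have "h (x + scale (-1) p) = h (p + scale (-1) p)"
      using p pU by (metis hom_add)
    then have "x + scale (-1) p \<in> hom_ker U h"
      using p(1) pU subalgD(1)[OF hom_subalg] by (simp add: hom_ker_def subspace_diff)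
    then have "(x + scale (-1) p) + p \<in> P" using P p subspace_add by blast
    then show "x \<in> P" by simp
  qed
qed (use P in \<open>auto simp: pull_def\<close>)

lemma ker_ideal: "ideal_in U (hom_ker U h)"
proof -
  have "hom_ker U h = pull U h (h ` {0})" by (auto simp: hom_ker_def pull_def)
  then show ?thesis using pull_ideal image_ideal ideal_zero hom_subalg by metis
qed

lemma span_image:
  assumes "X \<subseteq> U" shows "lie_span Q (h ` X) = h ` span X"
proof
  have "span X \<subseteq> U" using assms hom_subalg by (simp add: span_minimal subalgD)
  then show "lie_span Q (h ` X) \<subseteq> h ` span X"
    unfolding lie_span_def by (intro Inter_lower) (auto simp: image_subspace span_base)
  show "h ` span X \<subseteq> lie_span Q (h ` X)"
    unfolding lie_span_def
  proof (intro Inter_greatest; clarify)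
    fix W x assume W: "lie_subspace Q W" "h ` X \<subseteq> W" "x \<in> span X"
    then have "X \<subseteq> pull U h W" using assms by (auto simp: pull_def)
    then have "span X \<subseteq> pull U h W" using W pull_subspace span_minimal by blast
    then show "h x \<in> W" using W by (auto simp: pull_def)
  qed
qed

lemma prod_image:
  assumes "A \<subseteq> U" "B \<subseteq> U" shows "lie_prod Q (h ` A) (h ` B) = h ` br A B"
proof -
  have "{lie_bracket Q a b |a b. a \<in> h ` A \<and> b \<in> h ` B} = h ` {bracket a b | a b. a \<in> A \<and> b \<in> B}"
  proof (intro equalityI subsetI)
    fix z assume "z \<in> {lie_bracket Q a b |a b. a \<in> h ` A \<and> b \<in> h ` B}"
    then obtain a b where ab: "a \<in> A" "b \<in> B" "z = lie_bracket Q (h a) (h b)" by blast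
    then have "z = h (bracket a b)" using assms hom_bracket by blast
    then show "z \<in> h ` {bracket a b | a b. a \<in> A \<and> b \<in> B}" using ab by blast
  next
    fix z assume "z \<in> h ` {bracket a b | a b. a \<in> A \<and> b \<in> B}"
    then obtain a b where ab: "a \<in> A" "b \<in> B" "z = h (bracket a b)" by blast
    then have "z = lie_bracket Q (h a) (h b)" using assms hom_bracket by (metis subsetD)
    then show "z \<in> {lie_bracket Q a b |a b. a \<in> h ` A \<and> b \<in> h ` B}" using ab by blast
  qed
  moreover have "{bracket a b | a b. a \<in> A \<and> b \<in> B} \<subseteq> U"
    using assms hom_subalg subalgD by blast
  ultimately show ?thesis by (simp add: lie_prod_def br_def span_image)
qed

lemma lower_image: "lower_central Q k = h ` lower U k"
  by (induction k) (auto simp: hom_carrier prod_image lower_subset hom_subalg)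

lemma derived_image: "derived_series Q k = h ` derived U k"
  by (induction k) (auto simp: hom_carrier prod_image derived_subset hom_subalg)

lemma nilpotent_image: "lie_nilpotent Q \<longleftrightarrow> nil_mod U (hom_ker U h)"
proof -
  have "h ` lower U k = {h 0} \<longleftrightarrow> lower U k \<subseteq> hom_ker U h" for k
  proof -
    have "0 \<in> lower U k" using hom_subalg subalgD subspace_lower subspace_0 by blast
    then show ?thesis using lower_subset[OF hom_subalg, of k] by (auto simp: hom_ker_def)
  qed
  then show ?thesis by (simp add: lie_nilpotent_def nil_mod_def lower_image hom_zero)
qed

end

text \<open>The kernel on \<open>J\<close> is only \<open>hom_ker U h \<inter> J\<close>, but the
  lower series of \<open>J\<close> stays in \<open>J\<close>, so testing it against the full kernel
  is the same.\<close>

lemma nilpotent_restrict_image: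
  assumes "onto_hom U Q h" "subalg J" "J \<subseteq> U"
  shows "lie_nilpotent (lie_restrict Q (h ` J)) \<longleftrightarrow> nil_mod J (hom_ker U h)"
proof -
  have "hom_ker J h = hom_ker U h \<inter> J" using assms by (auto simp: hom_ker_def)
  then show ?thesis
    using nilpotent_image[OF onto_hom_restrict[OF assms]] lower_subset[OF assms(2)]
    by (auto simp: nil_mod_def)
qed

text \<open>The nilpotent ideals of \<open>Q\<close> are exactly the images of the ideals above the
  kernel that are nilpotent modulo it. Hence the two spans correspond, and \<open>pull_image\<close>
  recovers the preimage because the span contains the kernel.\<close>

lemma pull_nilradical:
  assumes hom: "onto_hom U Q h"
  shows "pull U h (nilradical Q) = nilrad_mod U (hom_ker U h)"
proof -
  let ?K = "hom_ker U h"
  let ?X = "{J. ideal_in U J \<and> ?K \<subseteq> J \<and> nil_mod J ?K}"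
  have "{I. lie_ideal Q I \<and> lie_nilpotent (lie_restrict Q I)} = (\<lambda>J. h ` J) ` ?X"
  proof (intro equalityI subsetI)
    fix I assume "I \<in> {I. lie_ideal Q I \<and> lie_nilpotent (lie_restrict Q I)}"
    then have I: "lie_ideal Q I" "lie_nilpotent (lie_restrict Q I)" "lie_subspace Q I"
      by (auto simp: lie_ideal_def)
    have P: "ideal_in U (pull U h I)" by (rule pull_ideal[OF hom I(1)])
    moreover have "nil_mod (pull U h I) ?K"
      using nilpotent_restrict_image[OF hom ideal_subalg[OF P] idealD(2)[OF P]] I
      by (simp add: image_pull[OF hom])
    ultimately have "pull U h I \<in> ?X" using ker_subset_pull[OF hom I(3)] by simp
    then show "I \<in> (\<lambda>J. h ` J) ` ?X" by (rule image_eqI[rotated]) (simp add: image_pull[OF hom I(3)])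
  next
    fix I assume "I \<in> (\<lambda>J. h ` J) ` ?X"
    then obtain J where J: "I = h ` J" "ideal_in U J" "nil_mod J ?K" by blast
    then show "I \<in> {I. lie_ideal Q I \<and> lie_nilpotent (lie_restrict Q I)}"
      using image_ideal[OF hom J(2)] nilpotent_restrict_image[OF hom ideal_subalg[OF J(2)] idealD(2)[OF J(2)]]
      by simp
  qed
  then have "\<Union>{I. lie_ideal Q I \<and> lie_nilpotent (lie_restrict Q I)} = h ` \<Union>?X"
    by (simp add: image_Union)
  moreover have "\<Union>?X \<subseteq> U" using idealD(2) by blast
  ultimately have "nilradical Q = h ` nilrad_mod U ?K"
    by (simp add: nilradical_def nilrad_mod_def span_image[OF hom])
  moreover have N: "ideal_in U (nilrad_mod U ?K)" by (rule nilrad_ideal[OF hom_subalg[OF hom]])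
  ultimately show ?thesis
    using pull_image[OF hom idealD(1)[OF N] idealD(2)[OF N]] nilrad_contains[OF ker_ideal[OF hom]] by simp
qed

lemma image_max_subalg:
  assumes hom: "onto_hom U Q h" and M: "max_subalg U M" "hom_ker U h \<subseteq> M"
  shows "maximal_subalgebra Q (h ` M)"
  unfolding maximal_subalgebra_def
proof (intro conjI allI impI)
  have sub: "subalg M" "subspace M" "M \<subset> U" using M by (auto simp: max_subalg_def subalg_def)
  show "lie_subalgebra Q (h ` M)" using image_subalg[OF hom] sub by auto
  have eq: "pull U h (h ` M) = M" using pull_image[OF hom] sub M by auto
  then show "h ` M \<noteq> lie_carrier Q" using sub by (auto simp: pull_def hom_carrier[OF hom])
  fix S assume S: "lie_subalgebra Q S \<and> h ` M \<subseteq> S"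
  then have "subalg (pull U h S)" "M \<subseteq> pull U h S" "pull U h S \<subseteq> U" "lie_subspace Q S"
    using pull_subalg[OF hom] sub by (auto simp: pull_def lie_subalgebra_def)
  then show "S = h ` M \<or> S = lie_carrier Q"
    using M(1) image_pull[OF hom] hom_carrier[OF hom] unfolding max_subalg_def by metis
qed

lemma pull_max_subalg:
  assumes hom: "onto_hom U Q h" and M: "maximal_subalgebra Q M"
  shows "max_subalg U (pull U h M)" "hom_ker U h \<subseteq> pull U h M"
proof -
  have sub: "lie_subalgebra Q M" "lie_subspace Q M" "M \<noteq> lie_carrier Q"
    using M by (auto simp: maximal_subalgebra_def lie_subalgebra_def)
  show ker: "hom_ker U h \<subseteq> pull U h M" by (rule ker_subset_pull[OF hom sub(2)])
  have ne: "pull U h M \<noteq> U" using image_pull[OF hom sub(2)] hom_carrier[OF hom] sub(3) by auto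
  have "S = pull U h M \<or> S = U" if S: "subalg S" "pull U h M \<subseteq> S" "S \<subseteq> U" for S
  proof -
    have "M \<subseteq> h ` S" using image_mono[OF S(2), of h] by (simp only: image_pull[OF hom sub(2)])
    then have "h ` S = M \<or> h ` S = h ` U"
      using M image_subalg[OF hom S(1,3)] unfolding maximal_subalgebra_def hom_carrier[OF hom] by simp
    moreover have "pull U h (h ` S) = S"
      by (rule pull_image[OF hom subalgD(1)[OF S(1)] S(3) order_trans[OF ker S(2)]])
    moreover have "pull U h (h ` U) = U" by (auto simp: pull_def)
    ultimately show ?thesis by metis
  qed
  then show "max_subalg U (pull U h M)"
    using pull_subalg[OF hom sub(1)] ne by (auto simp: max_subalg_def pull_def)
qed

lemma pull_frattini:
  assumes hom: "onto_hom U Q h"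
  shows "pull U h (frattini Q) = frat_mod U (hom_ker U h)"
proof (intro equalityI subsetI)
  fix x assume x: "x \<in> pull U h (frattini Q)"
  have "x \<in> M" if M: "max_subalg U M" "hom_ker U h \<subseteq> M" for M
  proof -
    have "h x \<in> h ` M" using image_max_subalg[OF hom M] x by (auto simp: pull_def frattini_def)
    then have "x \<in> pull U h (h ` M)" using x by (simp add: pull_def)
    then show ?thesis using pull_image[OF hom] M by (auto simp: max_subalg_def subalg_def)
  qed
  then show "x \<in> frat_mod U (hom_ker U h)" using x by (auto simp: frat_mod_def pull_def)
next
  fix x assume x: "x \<in> frat_mod U (hom_ker U h)"
  then have "h x \<in> M" if "maximal_subalgebra Q M" for M
    using pull_max_subalg[OF hom that] by (auto simp: frat_mod_def pull_def)
  then show "x \<in> pull U h (frattini Q)"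
    using x by (auto simp: frat_mod_def pull_def frattini_def hom_carrier[OF hom])
qed

text \<open>Phrased for any surjection, since \<open>supplement_chief\<close> applies it to two
  surjections onto the same quotient.\<close>

lemma minimal_ideal_image:
  assumes hom: "onto_hom U Q h" and A: "ideal_in U A" "hom_ker U h \<subset> A"
  shows "minimal_ideal Q (h ` A) \<longleftrightarrow> chief U A (hom_ker U h)"
proof
  have pA: "pull U h (h ` A) = A" using pull_image[OF hom] A idealD by blast
  have zQ: "h ` hom_ker U h = {h 0}"
    using subalgD(1)[OF hom_subalg[OF hom]] subspace_0 by (auto simp: hom_ker_def)
  show "chief U A (hom_ker U h)" if m: "minimal_ideal Q (h ` A)"
    unfolding chief_def
  proof (intro conjI allI impI)
    fix J assume J: "ideal_in U J \<and> hom_ker U h \<subseteq> J \<and> J \<subseteq> A"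
    then have "h ` J = {h 0} \<or> h ` J = h ` A"
      using m image_ideal[OF hom] unfolding minimal_ideal_def hom_zero[OF hom] by blast
    moreover have "pull U h (h ` J) = J" using pull_image[OF hom] J idealD by blast
    moreover have "pull U h {h 0} = hom_ker U h" by (auto simp: pull_def hom_ker_def)
    ultimately show "J = hom_ker U h \<or> J = A" using pA by metis
  qed (use A ker_ideal[OF hom] in auto)
  show "minimal_ideal Q (h ` A)" if c: "chief U A (hom_ker U h)"
    unfolding minimal_ideal_def hom_zero[OF hom]
  proof (intro conjI allI impI)
    show "lie_ideal Q (h ` A)" using image_ideal[OF hom A(1)] .
    show "h ` A \<noteq> {h 0}" using A idealD(2)[OF A(1)] by (auto simp: hom_ker_def)
    fix J assume J: "lie_ideal Q J \<and> J \<subseteq> h ` A"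
    then have s: "lie_subspace Q J" by (simp add: lie_ideal_def)
    have "pull U h J \<subseteq> A" using J pA by (auto simp: pull_def)
    then have "pull U h J = hom_ker U h \<or> pull U h J = A"
      using c J pull_ideal[OF hom] ker_subset_pull[OF hom s] unfolding chief_def by blast
    then show "J = {h 0} \<or> J = h ` A" using image_pull[OF hom s] zQ by metis
  qed
qed

section \<open>The notions of the statement in terms of subsets\<close>

abbreviation whole where "whole \<equiv> lie_of scale bracket"

lemma ideal_iff: "lie_ideal (lie_restrict whole U) I \<longleftrightarrow> ideal_in U I"
  by (auto simp: lie_ideal_def ideal_in_def lie_subspace_def subspace_def lie_restrict_def lie_of_def)

lemma onto_hom_id: "subalg U \<Longrightarrow> onto_hom U (lie_restrict whole U) (\<lambda>x. x)"
  by (auto simp: onto_hom_def lie_restrict_def lie_of_def)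

lemma ker_id: "subspace U \<Longrightarrow> hom_ker U (\<lambda>x. x) = {0}"
  by (auto simp: hom_ker_def subspace_0)

lemma coset_eq: "lie_coset (lie_restrict whole U) I = (\<lambda>x. (+) x ` I)"
  by (auto simp: lie_coset_def lie_restrict_def lie_of_def)

lemma onto_hom_quot:
  assumes "subalg U" "ideal_in U I"
  shows "onto_hom U (lie_quot (lie_restrict whole U) I) (lie_coset (lie_restrict whole U) I)"
proof -
  have I: "lie_ideal (lie_restrict whole U) I" using assms by (simp add: ideal_iff)
  show ?thesis unfolding onto_hom_def
  proof (intro conjI ballI allI)
    show "lie_carrier (lie_quot (lie_restrict whole U) I) = lie_coset (lie_restrict whole U) I ` U"
      by (simp add: lie_quot_def lie_restrict_def)
    show "lie_zero (lie_quot (lie_restrict whole U) I) = lie_coset (lie_restrict whole U) I 0"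
      by (simp add: lie_quot_def coset_eq)
  qed (use assms(1) lie_quot_coset[OF I] in auto)
qed

lemma ker_quot:
  assumes "subalg U" "ideal_in U I"
  shows "hom_ker U (lie_coset (lie_restrict whole U) I) = I"
proof -
  have I: "subspace I" "I \<subseteq> U" using assms by (auto simp: ideal_in_def)
  have "(+) x ` I = I \<longleftrightarrow> x \<in> I" for x
  proof
    assume "(+) x ` I = I"
    then show "x \<in> I" using subspace_0[OF I(1)] by (metis add.right_neutral imageI)
  next
    assume x: "x \<in> I"
    have "y \<in> (+) x ` I" if "y \<in> I" for y
      using subspace_diff[OF I(1) that x] by (intro image_eqI[of _ _ "y - x"]) auto
    then show "(+) x ` I = I" using x subspace_add[OF I(1)] by auto
  qed
  then show ?thesis using I by (auto simp: hom_ker_def coset_eq)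
qed

lemma nilradical_eq: "subalg U \<Longrightarrow> nilradical (lie_restrict whole U) = nilrad_mod U {0}"
proof -
  assume U: "subalg U"
  \<comment> \<open>\<open>pull\<close> sees only elements of \<open>U\<close>. The inclusion holds
    because \<open>U\<close> is itself one of the subspaces intersected in
    \<open>lie_span\<close>.\<close>
  have "nilradical (lie_restrict whole U) \<subseteq> U"
    unfolding nilradical_def lie_span_def
    using subalgD(1)[OF U]
    by (intro Inter_lower)
      (auto simp: lie_subspace_def lie_ideal_def lie_restrict_def lie_of_def subspace_def)
  then show ?thesis
    using pull_nilradical[OF onto_hom_id[OF U]] ker_id U by (auto simp: pull_def subalg_def)
qed

lemma frattini_eq: "subalg U \<Longrightarrow> frattini (lie_restrict whole U) = frat_mod U {0}"
  using pull_frattini[OF onto_hom_id[of U]] ker_id[of U]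
  by (auto simp: pull_def subalg_def frattini_def lie_restrict_def)

lemma chief_factor_eq: 
  assumes U: "subalg U"
  shows "chief_factor (lie_restrict whole U) A B \<longleftrightarrow> chief U A B"
\<comment> \<open>The coset map is a homomorphism only when \<open>B\<close> is an ideal; in the
  other case both sides fail by their own side conditions.\<close>
proof (cases "ideal_in U A \<and> ideal_in U B \<and> B \<subset> A")
  case True
  then show ?thesis
    using minimal_ideal_image[OF onto_hom_quot[OF U, of B], of A] ker_quot[OF U, of B]
    by (simp add: chief_factor_def ideal_iff)
next
  case False
  then show ?thesis by (auto simp: chief_factor_def ideal_iff chief_def)
qed

lemma restrict_UNIV: "lie_restrict whole UNIV = whole"
  by (simp add: lie_restrict_def lie_of_def)

lemma nilrad_quot:
  assumes "ideal_in UNIV I"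
  shows "{x \<in> lie_carrier whole. lie_coset whole I x \<in> nilradical (lie_quot whole I)} = nilrad_mod UNIV I"
  using pull_nilradical[OF onto_hom_quot[OF subalg_UNIV assms]] ker_quot[OF subalg_UNIV assms]
  by (simp add: pull_def restrict_UNIV) (simp add: lie_of_def)

lemma upper_nil_ideal: "ideal_in UNIV (upper_nil whole i)"
proof (induction i)
  case 0
  then show ?case using ideal_zero[OF subalg_UNIV] by (simp add: lie_of_def)
next
  case (Suc i)
  show ?case using nilrad_quot[OF Suc] nilrad_ideal[OF subalg_UNIV] by simp
qed

lemma upper_nil_Suc: "upper_nil whole (Suc i) = nilrad_mod UNIV (upper_nil whole i)"
  using nilrad_quot[OF upper_nil_ideal] by simp

lemma upper_frattini_eq: "upper_frattini whole (Suc i) = frat_mod UNIV (upper_nil whole i)"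
  using pull_frattini[OF onto_hom_quot[OF subalg_UNIV upper_nil_ideal[of i]]] ker_quot[OF subalg_UNIV upper_nil_ideal[of i]]
  by (simp add: upper_frattini_def pull_def restrict_UNIV) (simp add: lie_of_def)

end

text \<open>Finds an index at which a property sets in; \<open>engel_solvable\<close> uses it for a
  derived series and for the powers of an inner derivation.\<close>

lemma nat_switch: "\<not> P 0 \<Longrightarrow> P k \<Longrightarrow> \<exists>i. \<not> P i \<and> P (Suc i)"
  by (induction k) auto

context lie_algebra
begin

subsection \<open>Supplements of ideals\<close>

lemma image_ker_plus:
  assumes hom: "onto_hom P Q h" and T: "T \<subseteq> P" and X: "X \<subseteq> hom_ker P h + T"
  shows "h ` X \<subseteq> h ` T"
proof
  fix y assume "y \<in> h ` X"
  then obtain b t where bt: "b \<in> hom_ker P h" "t \<in> T" "y = h (b + t)"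
    using X by (auto elim!: set_plus_elim dest!: subsetD)
  have P: "0 \<in> P" "b \<in> P" "t \<in> P"
    using bt T subspace_0[OF subalgD(1)[OF hom_subalg[OF hom]]] by (auto simp: hom_ker_def)
  have "h (b + t) = lie_add Q (h 0) (h t)"
    using bt(1) P hom_add[OF hom, of b t] by (simp add: hom_ker_def)
  also have "\<dots> = h t" using hom_add[OF hom P(1,3)] by simp
  finally show "y \<in> h ` T" using bt by blast
qed

text \<open>Second isomorphism theorem without an isomorphism: as \<open>S\<close> supplements
  \<open>N\<close>, the coset map of \<open>N\<close> sends \<open>S\<close> onto the same quotient
  as \<open>P\<close>. Pulling one set back to \<open>P\<close> and to \<open>S\<close> then relates
  the two sides.\<close>

lemma onto_hom_supplement:
  assumes P: "subalg P" and N: "ideal_in P N" and S: "subalg S" "S \<subseteq> P" "P \<subseteq> N + S"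
  defines "h \<equiv> lie_coset (lie_restrict whole P) N"
  shows "onto_hom S (lie_quot (lie_restrict whole P) N) h" "hom_ker S h = N \<inter> S"
proof -
  note hom = onto_hom_quot[OF P N, folded h_def]
  note ker = ker_quot[OF P N, folded h_def]
  have "h ` S = h ` P" using image_ker_plus[OF hom S(2), of P] S ker by blast
  then show "onto_hom S (lie_quot (lie_restrict whole P) N) h" by (rule onto_hom_sub[OF hom S(1,2)])
  show "hom_ker S h = N \<inter> S" using ker S(2) by (auto simp: hom_ker_def)
qed

lemma pull_Int: "S \<subseteq> P \<Longrightarrow> pull S h X = pull P h X \<inter> S"
  by (auto simp: pull_def)

lemma supplement_nilrad:
  assumes "subalg P" "ideal_in P N" "subalg S" "S \<subseteq> P" "P \<subseteq> N + S"
  shows "nilrad_mod S (N \<inter> S) = nilrad_mod P N \<inter> S"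
  using pull_nilradical[OF onto_hom_quot[OF assms(1,2)]] pull_nilradical[OF onto_hom_supplement(1)[OF assms]]
    ker_quot[OF assms(1,2)] onto_hom_supplement(2)[OF assms] pull_Int[OF assms(4)]
  by metis

lemma supplement_frat:
  assumes "subalg P" "ideal_in P N" "subalg S" "S \<subseteq> P" "P \<subseteq> N + S"
  shows "frat_mod S (N \<inter> S) = frat_mod P N \<inter> S"
  using pull_frattini[OF onto_hom_quot[OF assms(1,2)]] pull_frattini[OF onto_hom_supplement(1)[OF assms]]
    ker_quot[OF assms(1,2)] onto_hom_supplement(2)[OF assms] pull_Int[OF assms(4)]
  by metis

lemma modular_law:
  assumes "subspace A" "B \<subseteq> A" "A \<subseteq> B + S" shows "A \<subseteq> B + A \<inter> S"
proof
  fix a assume a: "a \<in> A"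
  then obtain b s where bs: "b \<in> B" "s \<in> S" "a = b + s" using assms(3) by (auto elim!: set_plus_elim dest!: subsetD)
  then have "a - b \<in> A" using a assms by (intro subspace_diff) auto
  then show "a \<in> B + A \<inter> S" using bs by (auto intro: set_plus_intro)
qed

text \<open>Modulo \<open>B\<close>, the ideals \<open>A\<close> and \<open>A \<inter> S\<close>
  have the same image, and both sides say that this image is a minimal ideal. When
  \<open>A = B\<close> both sides are false.\<close>

lemma supplement_chief:
  assumes P: "subalg P" and B: "ideal_in P B" and S: "subalg S" "S \<subseteq> P" "P \<subseteq> B + S"
    and A: "ideal_in P A" "B \<subseteq> A"
  shows "chief P A B \<longleftrightarrow> chief S (A \<inter> S) (B \<inter> S)"
proof (cases "B = A")
  case True then show ?thesis by (simp add: chief_def)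
next
  case False
  let ?h = "lie_coset (lie_restrict whole P) B"
  note hP = onto_hom_quot[OF P B] and kP = ker_quot[OF P B]
  note hS = onto_hom_supplement[OF P B S]
  have As: "A \<subseteq> B + A \<inter> S"
    by (rule modular_law[OF idealD(1)[OF A(1)] A(2)]) (use S A idealD(2) in blast)
  have BS: "B \<inter> S \<noteq> A \<inter> S"
  proof
    assume "B \<inter> S = A \<inter> S"
    then have "A \<subseteq> B + B" using As set_plus_mono2[of B B "B \<inter> S" B] by auto
    then show False using plus_absorb[of B B B] idealD(1)[OF B] A(2) False by blast
  qed
  have "?h ` A = ?h ` (A \<inter> S)"
    using image_ker_plus[OF hP, of "A \<inter> S" A] As S(2) kP by auto
  moreover have "minimal_ideal (lie_quot (lie_restrict whole P) B) (?h ` A) \<longleftrightarrow> chief P A B"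
    using minimal_ideal_image[OF hP A(1)] kP A(2) False by auto
  moreover have "minimal_ideal (lie_quot (lie_restrict whole P) B) (?h ` (A \<inter> S)) \<longleftrightarrow> chief S (A \<inter> S) (B \<inter> S)"
    using minimal_ideal_image[OF hS(1) ideal_Int[OF A(1) S(1,2)]] hS(2) A(2) BS by auto
  ultimately show ?thesis by metis
qed

text \<open>Every maximal subalgebra already contains \<open>N\<close>, so demanding this discards
  none of them.\<close>

lemma frat_mod_absorb:
  "N \<subseteq> frat_mod S {0} \<Longrightarrow> frat_mod S N = frat_mod S {0}"
proof -
  assume N: "N \<subseteq> frat_mod S {0}"
  have "N \<subseteq> M \<longleftrightarrow> {0} \<subseteq> M" if "max_subalg S M" for M
  proof -
    have "0 \<in> M" using that subspace_0 by (auto simp: max_subalg_def subalg_def)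
    then show ?thesis using N that by (auto simp: frat_mod_def)
  qed
  then show ?thesis unfolding frat_mod_def by (metis (lifting))
qed

lemma subalg_normalized_plus:
  assumes A: "subalg A" and T: "subalg T" and AT: "\<And>a t. a \<in> A \<Longrightarrow> t \<in> T \<Longrightarrow> bracket a t \<in> A"
  shows "subalg (A + T)"
proof -
  have TA: "bracket t a \<in> A" if "a \<in> A" "t \<in> T" for a t
    using AT[OF that] subspace_neg[OF subalgD(1)[OF A]] bracket_skew[of t a] by simp
  have "bracket x y \<in> A + T" if xy: "x \<in> A + T" "y \<in> A + T" for x y
  proof -
    obtain a t b u where *: "a \<in> A" "t \<in> T" "b \<in> A" "u \<in> T" "x = a + t" "y = b + u"
      using xy by (auto elim!: set_plus_elim)
    have "bracket x y = (bracket a b + bracket a u + bracket t b) + bracket t u"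
      by (simp add: * bracket_add_left bracket_add_right)
    moreover have "bracket a b + bracket a u + bracket t b \<in> A"
      using * AT TA subalgD(2)[OF A] by (intro subspace_add[OF subalgD(1)[OF A]]) auto
    ultimately show ?thesis using * subalgD(2)[OF T] by auto
  qed
  then show ?thesis using subspace_plus A T by (auto simp: subalg_def)
qed

lemma ideal_derived: "subalg U \<Longrightarrow> ideal_in U J \<Longrightarrow> ideal_in U (derived J i)"
  by (induction i) (auto intro: ideal_br dest: subalgD)

lemma derived_mono: "A \<subseteq> B \<Longrightarrow> derived A i \<subseteq> derived B i"
  by (induction i) (auto dest: br_mono)

subsection \<open>Powers of inner derivations\<close>

lemma subspace_ad: "subspace P \<Longrightarrow> subspace ((bracket x ^^ m) ` P)"
proof (induction m)
  case (Suc m)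
  have *: "subspace (bracket x ` T)" if "subspace T" for T
    unfolding subspace_def
  proof (intro conjI ballI allI)
    show "0 \<in> bracket x ` T" using subspace_0[OF that] by (metis bracket_zero(2) imageI)
    fix y z assume "y \<in> bracket x ` T" "z \<in> bracket x ` T"
    then show "y + z \<in> bracket x ` T"
      using subspace_add[OF that] by (auto simp flip: bracket_add_right)
  next
    fix c y assume "y \<in> bracket x ` T"
    then show "scale c y \<in> bracket x ` T"
      using subspace_scale[OF that] by (auto simp flip: bracket_scale_right)
  qed
  show ?case using *[OF Suc.IH[OF Suc.prems]] by (simp add: image_comp)
qed simp

lemma ad_pow_add: "(bracket x ^^ m) (y + z) = (bracket x ^^ m) y + (bracket x ^^ m) z"
  by (induction m) (simp_all add: bracket_add_right)

lemma ad_pow_scale: "(bracket x ^^ m) (scale c y) = scale c ((bracket x ^^ m) y)"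
  by (induction m) (simp_all add: bracket_scale_right)

lemma ad_pow_zero: "(bracket x ^^ m) 0 = 0"
  by (induction m) simp_all

lemma ad_pow_mono: "(bracket x ^^ m) y = 0 \<Longrightarrow> m \<le> k \<Longrightarrow> (bracket x ^^ k) y = 0"
  using funpow_add[of "k - m" m "bracket x"] by (auto simp: ad_pow_zero)

text \<open>By the Leibniz formula the result is a combination of brackets of
  \<open>(bracket x ^^ i) y\<close> with \<open>(bracket x ^^ j) z\<close> where
  \<open>i + j = m + k\<close>, and then \<open>i \<ge> m\<close> or \<open>j \<ge> k\<close>.
  Induction on \<open>m + k\<close> avoids binomial coefficients: each application of
  \<open>leibniz\<close> lowers \<open>m\<close> or \<open>k\<close> by one.\<close>

lemma ad_pow_bracket:
  assumes "(bracket x ^^ m) y = 0" "(bracket x ^^ k) z = 0"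
  shows "(bracket x ^^ (m + k)) (bracket y z) = 0"
  using assms
proof (induction "m + k" arbitrary: m k y z)
  case 0 then show ?case by simp
next
  case (Suc s)
  show ?case
  proof (cases "m = 0 \<or> k = 0")
    case True
    then have "y = 0 \<or> z = 0" using Suc.prems by auto
    then show ?thesis by (auto simp: ad_pow_zero)
  next
    case False
    then obtain m' k' where mk: "m = Suc m'" "k = Suc k'" by (meson not0_implies_Suc)
    have "(bracket x ^^ s) (bracket (bracket x y) z) = 0"
      using Suc.hyps(1)[of m' k "bracket x y" z] Suc.hyps(2) Suc.prems mk by (simp add: funpow_swap1)
    moreover have "(bracket x ^^ s) (bracket y (bracket x z)) = 0"
      using Suc.hyps(1)[of m k' y "bracket x z"] Suc.hyps(2) Suc.prems mk by (simp add: funpow_swap1)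
    ultimately have "(bracket x ^^ s) (bracket x (bracket y z)) = 0"
      by (simp add: leibniz[of x y z] ad_pow_add)
    then show ?thesis using Suc.hyps(2)[symmetric] by (simp add: funpow_swap1)
  qed
qed

text \<open>The set is the Fitting null component of the inner derivation by
  \<open>x\<close>.\<close>

lemma subalg_ad_null: "subalg U \<Longrightarrow> subalg {y \<in> U. \<exists>m. (bracket x ^^ m) y = 0}"
  unfolding subalg_def
proof (intro conjI ballI)
  assume U: "subspace U \<and> (\<forall>x\<in>U. \<forall>y\<in>U. bracket x y \<in> U)"
  show "subspace {y \<in> U. \<exists>m. (bracket x ^^ m) y = 0}"
    unfolding subspace_def
  proof (intro conjI ballI allI)
    fix y z assume "y \<in> {y \<in> U. \<exists>m. (bracket x ^^ m) y = 0}" "z \<in> {y \<in> U. \<exists>m. (bracket x ^^ m) y = 0}"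
    then obtain m k where *: "y \<in> U" "z \<in> U" "(bracket x ^^ m) y = 0" "(bracket x ^^ k) z = 0" by blast
    then have "(bracket x ^^ (m + k)) (y + z) = 0"
      using ad_pow_mono[of m x y "m + k"] ad_pow_mono[of k x z "m + k"] by (simp add: ad_pow_add)
    then show "y + z \<in> {y \<in> U. \<exists>m. (bracket x ^^ m) y = 0}" using * U subspace_add by blast
  qed (use U in \<open>auto simp: ad_pow_scale subspace_scale subspace_0 ad_pow_zero\<close>)
  fix y z assume "y \<in> {y \<in> U. \<exists>m. (bracket x ^^ m) y = 0}" "z \<in> {y \<in> U. \<exists>m. (bracket x ^^ m) y = 0}"
  then show "bracket y z \<in> {y \<in> U. \<exists>m. (bracket x ^^ m) y = 0}"
    using U ad_pow_bracket by blast
qed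

end

section \<open>Finite dimension: extremal subspaces and chief factors\<close>

locale fd_lie_algebra = lie_algebra scale bracket + finite_dimensional_vector_space scale Basis
  for scale :: "'f::field \<Rightarrow> 'v::ab_group_add \<Rightarrow> 'v" and bracket Basis
begin

lemma dim_less: "subspace A \<Longrightarrow> subspace B \<Longrightarrow> A \<subset> B \<Longrightarrow> dim A < dim B"
  by (rule dim_psubset) (simp add: span_eq_iff[THEN iffD2])

lemma ex_max_subspace:
  assumes "P V" "\<And>W. P W \<Longrightarrow> subspace W"
  obtains W where "P W" "V \<subseteq> W" "\<forall>W'. P W' \<longrightarrow> W \<subseteq> W' \<longrightarrow> W' = W"
proof -
  have "\<exists>W. (P W \<and> V \<subseteq> W) \<and> (\<forall>W'. P W' \<and> V \<subseteq> W' \<longrightarrow> dim W' \<le> dim W)"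
    by (rule ex_has_greatest_nat[where b = "Suc dimension" and k = V])
      (use assms in \<open>auto simp: dim_subset_UNIV le_imp_less_Suc\<close>)
  then obtain W where W: "P W" "V \<subseteq> W" "\<And>W'. P W' \<Longrightarrow> V \<subseteq> W' \<Longrightarrow> dim W' \<le> dim W" by blast
  have "W' = W" if "P W'" "W \<subseteq> W'" for W'
    using dim_less[of W W'] W(3)[of W'] W(1,2) that assms(2) by fastforce
  then show thesis using that W by blast
qed

lemma ex_min_subspace:
  assumes "P V" "\<And>W. P W \<Longrightarrow> subspace W"
  obtains W where "P W" "\<forall>W'. P W' \<longrightarrow> W' \<subseteq> W \<longrightarrow> W' = W"
proof -
  obtain W where W: "P W" "\<And>W'. P W' \<Longrightarrow> dim W \<le> dim W'"
    using ex_has_least_nat[of P V dim, OF assms(1)] by blast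
  have "W' = W" if "P W'" "W' \<subseteq> W" for W'
    using dim_less[of W' W] W(2)[of W'] W(1) that assms(2) by fastforce
  then show thesis using that W by blast
qed

text \<open>For an ideal \<open>V\<close> this provides a chief factor V/W above \<open>K\<close>,
  the place where the nilpotency proofs do their work.\<close>

lemma ex_max_ideal:
  assumes "ideal_in U K" "K \<subset> V"
  obtains W where "ideal_in U W" "K \<subseteq> W" "W \<subset> V"
    "\<forall>W'. ideal_in U W' \<longrightarrow> W \<subseteq> W' \<longrightarrow> W' \<subseteq> V \<longrightarrow> W' = W \<or> W' = V"
proof -
  let ?P = "\<lambda>W. ideal_in U W \<and> W \<subset> V"
  show thesis
  proof (rule ex_max_subspace[of ?P K])
    fix W assume W: "?P W" "K \<subseteq> W" "\<forall>W'. ?P W' \<longrightarrow> W \<subseteq> W' \<longrightarrow> W' = W"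
    then show thesis by (intro that[of W]) blast+
  qed (use assms idealD(1) in auto)
qed

lemma ex_max_subalg:
  assumes "subalg S" "S \<subset> U"
  obtains M where "max_subalg U M" "S \<subseteq> M"
proof -
  let ?P = "\<lambda>W. subalg W \<and> W \<subset> U"
  show thesis
  proof (rule ex_max_subspace[of ?P S])
    fix M assume M: "?P M" "S \<subseteq> M" "\<forall>W'. ?P W' \<longrightarrow> M \<subseteq> W' \<longrightarrow> W' = M"
    then have "max_subalg U M" unfolding max_subalg_def by blast
    then show thesis using that M(2) by blast
  qed (use assms subalgD(1) in auto)
qed

text \<open>Each further bracket with \<open>S\<close> pushes the lower series of \<open>S\<close>
  into a smaller ideal above \<open>K\<close>, and dimensions can drop only until \<open>K\<close>
  is reached. Nilpotency is thereby reduced to annihilating one factor below each ideal.\<close>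

lemma nil_by_descent:
  assumes U: "subalg U" and S: "ideal_in U S" and K: "ideal_in U K"
    and step: "\<And>V. ideal_in U V \<Longrightarrow> K \<subset> V \<Longrightarrow> \<exists>W. ideal_in U W \<and> K \<subseteq> W \<and> W \<subset> V \<and> br S V \<subseteq> W"
  shows "nil_mod S K"
proof -
  have "nil_mod S K" if "ideal_in U V" "K \<subseteq> V" "lower S m \<subseteq> V" for V m
    using that
  proof (induction "dim V" arbitrary: V m rule: less_induct)
    case less
    show ?case
    proof (cases "K = V")
      case True then show ?thesis using less.prems(3) unfolding nil_mod_def by blast
    next
      case False
      then obtain W where W: "ideal_in U W" "K \<subseteq> W" "W \<subset> V" "br S V \<subseteq> W"
        using step[OF less.prems(1)] less.prems(2) by auto
      have "lower S (Suc m) \<subseteq> W" using br_mono[of S S "lower S m" V] less.prems W by auto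
      then show ?thesis
        using less.hyps[of W "Suc m"] W(1,2) dim_less[OF idealD(1)[OF W(1)] idealD(1)[OF less.prems(1)] W(3)]
        by blast
    qed
  qed
  from this[OF ideal_self[OF U], of 0] show ?thesis using S K idealD(2) by simp
qed

text \<open>Every nilpotent ideal annihilates every chief factor, hence so does the span of all of them.\<close>

lemma nilrad_nil:
  assumes U: "subalg U" and K: "ideal_in U K"
  shows "nil_mod (nilrad_mod U K) K"
proof (rule nil_by_descent[OF U nilrad_ideal[OF U] K])
  fix V assume V: "ideal_in U V" "K \<subset> V"
  obtain W where W: "ideal_in U W" "K \<subseteq> W" "W \<subset> V"
    "\<forall>W'. ideal_in U W' \<longrightarrow> W \<subseteq> W' \<longrightarrow> W' \<subseteq> V \<longrightarrow> W' = W \<or> W' = V"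
    by (rule ex_max_ideal[OF K V(2)])
  have Vs: "subspace V" "V \<subseteq> U" and Ws: "subspace W" using idealD(1,2)[OF V(1)] idealD(1)[OF W(1)] by auto
  have J: "br J V \<subseteq> W" if J: "ideal_in U J" "nil_mod J K" for J
  proof (rule ccontr)
    assume n: "\<not> br J V \<subseteq> W"
    have JU: "J \<subseteq> U" using J idealD by blast
    have "ideal_in U (br J V + W)" by (intro ideal_plus[OF U] ideal_br subalgD(1)[OF U] J V W)
    moreover have brV: "br J V \<subseteq> V"
      by (rule br_subset[OF Vs(1)]) (use JU idealD(3)[OF V(1)] in blast)
    then have "br J V + W \<subseteq> V" using W(3) by (intro plus_absorb Vs) auto
    ultimately have V_eq: "br J V + W = V"
      using W(4)[rule_format, of "br J V + W"] subset_plus[of "br J V" W] subset_plus[of W "br J V"] n Ws subspace_br by blast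
    \<comment> \<open>If \<open>J\<close> does not annihilate the chief factor, then [J,V] + W = V.
      Iterating this keeps \<open>V\<close> inside every term of the series plus \<open>W\<close>,
      although some term lies in \<open>K\<close> and hence in \<open>W\<close>.\<close>
    have "V \<subseteq> lower J k + W" for k
    proof (induction k)
      case 0
      have "br J V \<subseteq> J" by (rule br_subset[OF idealD(1)[OF J(1)]]) (use Vs idealD'[OF J(1)] in blast)
      then show ?case using V_eq set_plus_mono2[of "br J V" J W W] by auto
    next
      case (Suc k)
      have sub: "subspace (lower J (Suc k) + W)" by (simp add: subspace_plus subspace_br Ws)
      have "br J V \<subseteq> lower J (Suc k) + W"
      proof (rule br_subset[OF sub])
        fix j v assume j: "j \<in> J" and "v \<in> V"
        then obtain a w where "a \<in> lower J k" "w \<in> W" "v = a + w"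
          using Suc by (auto elim!: set_plus_elim dest!: subsetD)
        then show "bracket j v \<in> lower J (Suc k) + W"
          using j JU idealD(3)[OF W(1)] by (auto simp: bracket_add_right intro!: set_plus_intro brI)
      qed
      moreover have "W \<subseteq> lower J (Suc k) + W" by (intro subset_plus) (simp add: subspace_br)
      ultimately show ?case using V_eq plus_absorb[OF sub] by blast
    qed
    moreover obtain k where "lower J k \<subseteq> K" using J by (auto simp: nil_mod_def)
    ultimately have "V \<subseteq> W"
      using plus_absorb[of W "lower J k" W] W(2) Ws by blast
    then show False using W by blast
  qed
  let ?C = "{x. \<forall>v\<in>V. bracket x v \<in> W}"
  have "subspace ?C"
    using Ws by (auto simp: subspace_def bracket_add_left bracket_scale_left)
  moreover have "\<Union>{J. ideal_in U J \<and> K \<subseteq> J \<and> nil_mod J K} \<subseteq> ?C" using J brI by blast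
  ultimately have "nilrad_mod U K \<subseteq> ?C" unfolding nilrad_mod_def by (intro span_minimal)
  then have "br (nilrad_mod U K) V \<subseteq> W" by (intro br_subset Ws) blast
  then show "\<exists>W. ideal_in U W \<and> K \<subseteq> W \<and> W \<subset> V \<and> br (nilrad_mod U K) V \<subseteq> W" using W by blast
qed

text \<open>If \<open>J\<close> did not annihilate a chief factor \<open>V/W\<close>, then neither would some term \<open>A\<close> of its derived
  series whose successor does annihilate it. Then \<open>A\<close> acts on \<open>V/W\<close> by commuting nilpotent maps, so
  the elements of \<open>V/W\<close> killed by \<open>A\<close> form a nonzero submodule, which must be all of \<open>V/W\<close>.\<close>

lemma engel_solvable:
  assumes U: "subalg U" and J: "ideal_in U J" and solv: "derived J k \<subseteq> {0}"
    and nil: "\<And>x y. x \<in> J \<Longrightarrow> y \<in> U \<Longrightarrow> \<exists>m. (bracket x ^^ m) y = 0"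
  shows "nil_mod J {0}"
proof (rule nil_by_descent[OF U J ideal_zero[OF U]])
  fix V assume V: "ideal_in U V" "{0} \<subset> V"
  obtain W where W: "ideal_in U W" "{0} \<subseteq> W" "W \<subset> V"
    "\<forall>W'. ideal_in U W' \<longrightarrow> W \<subseteq> W' \<longrightarrow> W' \<subseteq> V \<longrightarrow> W' = W \<or> W' = V"
    by (rule ex_max_ideal[OF ideal_zero[OF U] V(2)])
  have Vs: "subspace V" "V \<subseteq> U" and Ws: "subspace W" using idealD(1,2)[OF V(1)] idealD(1)[OF W(1)] by auto
  have JU: "J \<subseteq> U" using J idealD by blast
  let ?C = "{x. \<forall>v\<in>V. bracket x v \<in> W}"
  have "J \<subseteq> ?C"
  proof (rule ccontr)
    assume "\<not> J \<subseteq> ?C"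
    moreover have "derived J k \<subseteq> ?C" using solv subspace_0[OF Ws] by auto
    ultimately obtain i where i: "\<not> derived J i \<subseteq> ?C" "derived J (Suc i) \<subseteq> ?C"
      using nat_switch[of "\<lambda>i. derived J i \<subseteq> ?C" k] by auto
    define A where "A = derived J i"
    have A: "ideal_in U A" "A \<subseteq> J"
      using ideal_derived[OF U J] derived_subset[OF ideal_subalg[OF J]] by (auto simp: A_def)
    have AA: "br A A \<subseteq> ?C" using i by (simp add: A_def)
    \<comment> \<open>Only \<open>A\<close>-invariance is asked of \<open>T\<close>: the kernel of a
      single \<open>x\<close> on V/W is invariant under \<open>A\<close>, because [A,A] annihilates
      V/W, but it need not be invariant under \<open>U\<close>.\<close>
    let ?P = "\<lambda>T. subspace T \<and> W \<subset> T \<and> T \<subseteq> V \<and> (\<forall>a\<in>A. \<forall>v\<in>T. bracket a v \<in> T)"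
    have PV: "?P V" using W(3) A(2) Vs idealD(3)[OF V(1)] JU by blast
    have Ps: "subspace T" if "?P T" for T using that by blast
    obtain T where T: "?P T" "\<forall>T'. ?P T' \<longrightarrow> T' \<subseteq> T \<longrightarrow> T' = T"
      by (rule ex_min_subspace[of ?P V, OF PV Ps])
    have TW: "bracket x t \<in> W" if x: "x \<in> A" and t: "t \<in> T" for x t
    proof -
      let ?Tx = "{v\<in>T. bracket x v \<in> W}"
      have "subspace ?Tx"
        using T(1) Ws by (auto simp: subspace_def bracket_add_right bracket_scale_right)
      moreover have "W \<subseteq> ?Tx" using T(1) x A JU idealD(3)[OF W(1)] by blast
      moreover have "W \<noteq> ?Tx"
      proof -
        obtain v where v: "v \<in> T" "v \<notin> W" using T(1) by blast
        have "v \<in> U" using v T(1) Vs by blast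
        then obtain m where "(bracket x ^^ m) v = 0" using nil x A by blast
        then have "(bracket x ^^ m) v \<in> W" using subspace_0[OF Ws] by simp
        then obtain m where m: "(bracket x ^^ m) v \<notin> W" "(bracket x ^^ Suc m) v \<in> W"
          using v(2) nat_switch[of "\<lambda>m. (bracket x ^^ m) v \<in> W" m] by auto
        have "(bracket x ^^ m) v \<in> T" using v(1) x T(1) by (induction m) auto
        then show ?thesis using m by auto
      qed
      moreover have "bracket a v \<in> ?Tx" if a: "a \<in> A" and v: "v \<in> ?Tx" for a v
      proof -
        have "bracket (bracket x a) v \<in> W" using AA brI[OF x a] v T(1) by blast
        moreover have "bracket a (bracket x v) \<in> W" using a v A JU idealD(3)[OF W(1)] by blast
        ultimately have "bracket x (bracket a v) \<in> W"
          by (simp add: leibniz[of x a v] subspace_add[OF Ws])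
        then show ?thesis using a v T(1) by blast
      qed
      ultimately have "?Tx = T" using T by (intro T(2)[rule_format]) blast+
      then show ?thesis using t by blast
    qed
    \<comment> \<open>Taking the common kernel of all \<open>x\<close> in \<open>A\<close> restores
      invariance under \<open>U\<close>, as \<open>A\<close> is an ideal.\<close>
    let ?Z = "{v\<in>V. \<forall>x\<in>A. bracket x v \<in> W}"
    have "ideal_in U ?Z"
      unfolding ideal_in_def
    proof (intro conjI ballI)
      show "subspace ?Z"
        using Vs Ws by (auto simp: subspace_def bracket_add_right bracket_scale_right)
      show "?Z \<subseteq> U" using Vs by blast
      fix u v assume u: "u \<in> U" and v: "v \<in> ?Z"
      have "bracket x (bracket u v) \<in> W" if x: "x \<in> A" for x
      proof -
        have "bracket (bracket x u) v \<in> W" using idealD'[OF A(1) u x] v by blast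
        moreover have "bracket u (bracket x v) \<in> W" using u v x idealD(3)[OF W(1)] by blast
        ultimately show ?thesis by (simp add: leibniz[of x u v] subspace_add[OF Ws])
      qed
      then show "bracket u v \<in> ?Z" using u v idealD(3)[OF V(1)] by blast
    qed
    moreover have "W \<subset> ?Z" using T(1) TW by blast
    ultimately have "?Z = V" using W(4)[rule_format, of ?Z] by blast
    then show False using i(1) by (auto simp: A_def)
  qed
  then have "br J V \<subseteq> W" by (intro br_subset Ws) blast
  then show "\<exists>W. ideal_in U W \<and> {0} \<subseteq> W \<and> W \<subset> V \<and> br J V \<subseteq> W" using W by blast
qed

section \<open>Fitting null components, minimal supplements and the Frattini subalgebra\<close>

text \<open>Fitting's argument: once the images of the powers of ad x are stable from exponent m to
  2m, the m-th power sends \<open>y\<close> to the same element as the 2m-th power sends some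
  \<open>z\<close>. The difference of \<open>y\<close> and (ad x)^m z is then killed by the m-th
  power.\<close>

lemma ad_null_supplement:
  assumes U: "subalg U" and x: "x \<in> U" and nil: "(bracket x ^^ k) ` U \<subseteq> K"
  shows "U \<subseteq> {y \<in> U. \<exists>m. (bracket x ^^ m) y = 0} + K"
proof
  fix y assume y: "y \<in> U"
  have Us: "subspace U" using U subalgD by blast
  have inU: "(bracket x ^^ m) z \<in> U" if "z \<in> U" for z m
    using that x subalgD(2)[OF U] by (induction m) auto
  \<comment> \<open>Minimizing over exponents from \<open>k\<close> on makes the image stable and
    also keeps it inside \<open>K\<close>.\<close>
  obtain m where m: "k \<le> m" "\<And>j. k \<le> j \<Longrightarrow> dim ((bracket x ^^ m) ` U) \<le> dim ((bracket x ^^ j) ` U)"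
    using ex_has_least_nat[of "\<lambda>j. k \<le> j" k "\<lambda>j. dim ((bracket x ^^ j) ` U)"] by blast
  have sub: "(bracket x ^^ (m + j)) ` U \<subseteq> (bracket x ^^ m) ` U" for j
    using inU by (auto simp: funpow_add)
  have "(bracket x ^^ (m + m)) ` U = (bracket x ^^ m) ` U"
  proof (rule ccontr)
    assume "(bracket x ^^ (m + m)) ` U \<noteq> (bracket x ^^ m) ` U"
    then have "(bracket x ^^ (m + m)) ` U \<subset> (bracket x ^^ m) ` U" using sub[of m] by (rule psubsetI[rotated])
    from dim_less[OF subspace_ad[OF Us] subspace_ad[OF Us] this] m(2)[of "m + m"] m(1)
    show False by simp
  qed
  then obtain z where z: "z \<in> U" "(bracket x ^^ m) y = (bracket x ^^ (m + m)) z" using y by blast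
  let ?w = "(bracket x ^^ m) z"
  have "(bracket x ^^ m) (y + scale (-1) ?w) = 0"
    by (simp only: ad_pow_add ad_pow_scale) (simp add: z(2) funpow_add)
  moreover have "y + scale (-1) ?w \<in> U" using y inU[OF z(1)] Us subspace_add subspace_scale by blast
  moreover have "?w \<in> K"
  proof -
    have "?w = (bracket x ^^ k) ((bracket x ^^ (m - k)) z)"
      using m(1) funpow_add[of k "m - k" "bracket x"] by simp
    then show ?thesis using nil inU[OF z(1)] by blast
  qed
  ultimately have "(y + scale (-1) ?w) + ?w \<in> {y \<in> U. \<exists>m. (bracket x ^^ m) y = 0} + K"
    by (intro set_plus_intro) blast+
  then show "y \<in> {y \<in> U. \<exists>m. (bracket x ^^ m) y = 0} + K" by simp
qed

text \<open>For \<open>x\<close> in an ideal that is nilpotent modulo \<open>K\<close>, the Fitting null component of \<open>ad x\<close> is a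
  subalgebra supplementing \<open>K\<close>, so it is all of \<open>U\<close> when \<open>K\<close> lies in the Frattini subalgebra.\<close>

lemma nilrad_mod_frattini:
  assumes U: "subalg U" and solv: "derived U r \<subseteq> {0}" and K: "ideal_in U K" "K \<subseteq> frat_mod U {0}"
  shows "nilrad_mod U K = nilrad_mod U {0}"
proof
  let ?M = "nilrad_mod U K"
  have M: "ideal_in U ?M" "nil_mod ?M K" "K \<subseteq> ?M" 
    using nilrad_ideal[OF U] nilrad_nil[OF U K(1)] nilrad_contains[OF K(1)] by auto
  have zK: "{0} \<subseteq> K" using K(1) idealD(1) subspace_0 by blast
  have "nil_mod ?M {0}"
  proof (rule engel_solvable[OF U M(1)])
    show "derived ?M r \<subseteq> {0}" using solv derived_mono[OF idealD(2)[OF M(1)]] by blast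
    fix x y assume x: "x \<in> ?M" and y: "y \<in> U"
    have xU: "x \<in> U" using x M idealD(2) by blast
    obtain k where k: "lower ?M k \<subseteq> K" using M(2) by (auto simp: nil_mod_def)
    \<comment> \<open>One bracket is spent on moving \<open>z\<close> from \<open>U\<close> into the
      ideal, where its lower series begins; hence \<open>Suc j\<close>.\<close>
    have "(bracket x ^^ Suc j) z \<in> lower ?M j" if "z \<in> U" for z j
      using that x idealD'[OF M(1)] by (induction j) (auto intro: brI)
    then have "(bracket x ^^ Suc k) ` U \<subseteq> K" using k by blast
    note sup = ad_null_supplement[OF U xU this]
    let ?N = "{y \<in> U. \<exists>m. (bracket x ^^ m) y = 0}"
    have "?N = U"
    proof (rule ccontr)
      assume "?N \<noteq> U"
      then have "?N \<subset> U" by blast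
      then obtain S where S: "max_subalg U S" "?N \<subseteq> S" by (rule ex_max_subalg[OF subalg_ad_null[OF U]])
      then have Ss: "subspace S" "S \<subset> U" by (auto simp: max_subalg_def subalg_def)
      then have "K \<subseteq> S" using K(2) S(1) subspace_0 by (auto simp: frat_mod_def)
      then have "U \<subseteq> S" using sup plus_absorb[OF Ss(1) S(2)] by blast
      then show False using Ss by blast
    qed
    then show "\<exists>m. (bracket x ^^ m) y = 0" using y by blast
  qed
  then show "?M \<subseteq> nilrad_mod U {0}" using nilrad_upper[OF M(1)] M(3) zK by blast
  \<comment> \<open>The nilradical now contains \<open>K\<close>, so it is one of the ideals whose
    span is \<open>nilrad_mod U K\<close>.\<close>
  then have "K \<subseteq> nilrad_mod U {0}" using M by blast
  moreover have "nil_mod (nilrad_mod U {0}) K"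
    using nilrad_nil[OF U ideal_zero[OF U]] zK by (auto simp: nil_mod_def)
  ultimately show "nilrad_mod U {0} \<subseteq> ?M" by (rule nilrad_upper[OF nilrad_ideal[OF U]])
qed

text \<open>Take \<open>S\<close> of minimal dimension. If a maximal subalgebra \<open>M\<close> of
  \<open>S\<close> missed part of \<open>N \<inter> S\<close>, maximality would give
  \<open>N \<inter> S + M = S\<close>, and the smaller \<open>M\<close> would already supplement
  \<open>N\<close>.\<close>

lemma ex_min_supplement:
  assumes U: "subalg U" and N: "ideal_in U N"
  obtains S where "subalg S" "S \<subseteq> U" "U \<subseteq> N + S" "N \<inter> S \<subseteq> frat_mod S {0}"
proof -
  let ?P = "\<lambda>S. subalg S \<and> S \<subseteq> U \<and> U \<subseteq> N + S"
  have PU: "?P U" using U subset_plus(1)[OF idealD(1)[OF N]] by blast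
  have Ps: "subspace S" if "?P S" for S using that subalgD(1) by blast
  obtain S where S: "?P S" "\<forall>T. ?P T \<longrightarrow> T \<subseteq> S \<longrightarrow> T = S"
    by (rule ex_min_subspace[of ?P U, OF PU Ps])
  have "N \<inter> S \<subseteq> M" if M: "max_subalg S M" for M
  proof (rule ccontr)
    assume n: "\<not> N \<inter> S \<subseteq> M"
    have Ms: "subalg M" "M \<subset> S" "subspace M" using M by (auto simp: max_subalg_def subalg_def)
    have I: "ideal_in S (N \<inter> S)" using ideal_Int N S(1) by blast
    have "subalg (N \<inter> S + M)" 
      by (rule subalg_normalized_plus[OF ideal_subalg[OF I] Ms(1)]) (use idealD'[OF I] Ms(2) in blast)
    moreover have "N \<inter> S + M \<subseteq> S" using Ms S(1) by (intro plus_absorb) (auto dest: subalgD)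
    moreover have "M \<subseteq> N \<inter> S + M" "N \<inter> S \<subseteq> N \<inter> S + M"
      using subset_plus[OF idealD(1)[OF I]] subset_plus(2)[OF Ms(3)] by auto
    ultimately have eq: "N \<inter> S + M = S" using M n unfolding max_subalg_def by blast
    have sub: "subspace (N + M)" using subspace_plus Ms N idealD(1) by blast
    have NM: "N \<subseteq> N + M" "M \<subseteq> N + M" using subset_plus(2)[OF Ms(3)] subset_plus(1)[OF idealD(1)[OF N]] by auto
    then have "N \<inter> S + M \<subseteq> N + M" by (intro plus_absorb[OF sub]) auto
    then have "S \<subseteq> N + M" using eq by simp
    then have "N + S \<subseteq> N + M" using NM by (intro plus_absorb[OF sub]) auto
    then have "?P M" using S(1) Ms(1,2) by blast
    then show False using S(2)[rule_format, of M] Ms(2) by blast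
  qed
  then have "N \<inter> S \<subseteq> frat_mod S {0}" by (auto simp: frat_mod_def)
  then show thesis using that S(1) by blast
qed

text \<open>A maximal proper subspace \<open>H\<close> containing [A,A] is both an ideal and a
  maximal subalgebra, so it contains the Frattini subalgebra and, by chiefness, equals it. For
  \<open>x\<close> outside \<open>H\<close>, a maximal subalgebra through \<open>x\<close> would
  contain \<open>H\<close> and so coincide with it; hence \<open>x\<close> spans
  \<open>A\<close>.\<close>

lemma nil_chief_dim:
  assumes A: "subalg A" and nil: "nil_mod A {0}" and chief: "chief A A (frat_mod A {0})"
  shows "dim A = 1"
proof -
  let ?F = "frat_mod A {0}"
  have As: "subspace A" using A subalgD by blast
  have F: "?F \<subset> A" "0 \<in> ?F" using chief subspace_0[OF subspace_frat[OF A]] by (auto simp: chief_def)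
  have "br A A \<subseteq> A" by (rule br_subset[OF As]) (rule subalgD(2)[OF A])
  moreover have "br A A \<noteq> A"
  proof
    assume eq: "br A A = A"
    have "lower A k = A" for k by (induction k) (auto simp: eq)
    then show False using nil F by (auto simp: nil_mod_def)
  qed
  ultimately have PA: "subspace (br A A) \<and> br A A \<subset> A" using subspace_br by blast
  obtain H where H0: "subspace H \<and> H \<subset> A" and H3: "br A A \<subseteq> H"
      and H4: "\<forall>W. subspace W \<and> W \<subset> A \<longrightarrow> H \<subseteq> W \<longrightarrow> W = H"
    by (rule ex_max_subspace[of "\<lambda>W. subspace W \<and> W \<subset> A", OF PA conjunct1])
  have H: "subspace H" "H \<subset> A" "br A A \<subseteq> H"
    and H_max: "\<And>W. subspace W \<Longrightarrow> W \<subset> A \<Longrightarrow> H \<subseteq> W \<Longrightarrow> W = H"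
    using H0 H3 H4 by auto
  have HA: "bracket a h \<in> H" if "a \<in> A" "h \<in> A" for a h using that brI H(3) by blast
  then have "subalg H" "ideal_in A H" using H(1,2) by (auto simp: subalg_def ideal_in_def)
  then have "max_subalg A H"
    unfolding max_subalg_def using H(2) H_max subalgD(1) by (metis psubsetI)
  then have "?F \<subseteq> H" using subspace_0[OF H(1)] by (auto simp: frat_mod_def)
  then have FH: "?F = H" using chief \<open>ideal_in A H\<close> H(2) unfolding chief_def by blast
  obtain x where x: "x \<in> A" "x \<notin> H" using H(2) by blast
  have span: "span {x} \<subseteq> A" using x As by (intro span_minimal) auto
  have "subalg (span {x})"
    unfolding subalg_def
    by (rule conjI[OF subspace_span])
      (auto simp: span_singleton bracket_scale_left bracket_scale_right bracket_self intro: range_eqI[of _ _ 0])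
  have "span {x} = A"
  proof (rule ccontr)
    assume "span {x} \<noteq> A"
    then have "span {x} \<subset> A" using span by blast
    then obtain M where M: "max_subalg A M" "span {x} \<subseteq> M"
      by (rule ex_max_subalg[OF \<open>subalg (span {x})\<close>])
    have Ms: "subspace M" "M \<subset> A" using M by (auto simp: max_subalg_def subalg_def)
    then have "H \<subseteq> M" using M(1) subspace_0[OF Ms(1)] FH by (auto simp: frat_mod_def)
    then have "M = H" using H_max Ms by blast
    then show False using M(2) x span_base by blast
  qed
  then show ?thesis using dim_span[of "{x}"] dim_singleton[of x] x(2) subspace_0[OF H(1)] by auto
qed

end

context lie_algebra
begin

section \<open>Ideals and tails obtained from supplements\<close>

lemma subalgebra_eq: "lie_subalgebra whole S \<longleftrightarrow> subalg S"
  by (auto simp: lie_subalgebra_def subalg_def lie_subspace_def subspace_def lie_of_def)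

lemma nilpotent_restrict_eq: "subalg S \<Longrightarrow> lie_nilpotent (lie_restrict whole S) \<longleftrightarrow> nil_mod S {0}"
  using nilpotent_image[OF onto_hom_id[of S]] ker_id[of S] subalgD(1) by simp

lemma prod_eq: "lie_prod whole A B = br A B"
  using prod_image[OF onto_hom_id[OF subalg_UNIV], of A B] by (simp add: restrict_UNIV)

lemma solvable_eq: "lie_solvable whole \<Longrightarrow> \<exists>r. derived UNIV r \<subseteq> {0}"
proof -
  have "derived_series whole k = derived UNIV k" for k
    using derived_image[OF onto_hom_id[OF subalg_UNIV]] by (simp add: restrict_UNIV)
  moreover have "lie_zero whole = 0" by (simp add: lie_of_def)
  ultimately show "lie_solvable whole \<Longrightarrow> ?thesis" by (auto simp: lie_solvable_def)
qed

lemma upper_nil_mono: "upper_nil whole i \<subseteq> upper_nil whole (Suc i)"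
  using nilrad_contains[OF upper_nil_ideal] upper_nil_Suc by simp

lemma upper_nil_zero: "upper_nil whole 0 = {0}"
  by (simp add: lie_of_def)

text \<open>Splitting both arguments along \<open>N + S\<close>, every part of the bracket lies in
  \<open>N\<close> except the bracket of the two \<open>S\<close>-components, and that one is
  covered by the ideal of \<open>S\<close>. Applied to a Frattini preimage whose trace on
  \<open>S\<close> is known to be an ideal.\<close>

lemma ideal_from_supplement:
  assumes N: "ideal_in UNIV N" and S: "UNIV \<subseteq> N + S" "subspace S" and B: "subspace B" "N \<subseteq> B" "ideal_in S (B \<inter> S)"
  shows "ideal_in UNIV B"
  unfolding ideal_in_def
proof (intro conjI ballI)
  fix x y assume "y \<in> B"
  moreover have "B \<subseteq> N + B \<inter> S" using modular_law[OF B(1,2)] S(1) by blast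
  ultimately obtain b t where bt: "b \<in> N" "t \<in> B \<inter> S" "y = b + t" by (auto elim!: set_plus_elim dest!: subsetD)
  obtain a s where as: "a \<in> N" "s \<in> S" "x = a + s" using S(1) by (auto elim!: set_plus_elim dest!: subsetD)
  have "bracket x y = (bracket x b + bracket a t) + bracket s t"
    by (simp add: bt(3) bracket_add_right) (simp add: as(3) bracket_add_left add.assoc)
  moreover have "bracket x b \<in> B" "bracket a t \<in> B" "bracket s t \<in> B"
    using idealD(3)[OF N, of x b] idealD'[OF N, of t a] idealD(3)[OF B(3), of s t] as bt B(2) by auto
  ultimately show "bracket x y \<in> B" by (simp add: subspace_add[OF B(1)])
qed (use B in auto)

text \<open>The second conjunct strengthens the induction: a tail that normalizes \<open>B k\<close>
  can be enlarged by \<open>B k\<close>. The induction descends from the empty sum {0} at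
  \<open>Suc n\<close>, which explains the intersection with \<open>{1..n}\<close>.\<close>

lemma subalg_tail:
  assumes "\<And>i. i \<in> {1..n} \<Longrightarrow> subalg (B i)"
    and "\<And>i j. 1 \<le> i \<Longrightarrow> i \<le> j \<Longrightarrow> j \<le> n \<Longrightarrow> br (B i) (B j) \<subseteq> B i"
    and "1 \<le> k" "k \<le> Suc n"
  shows "subalg (\<Sum>j\<in>{k..n}. B j) \<and>
    (\<forall>i\<in>{1..k} \<inter> {1..n}. \<forall>a\<in>B i. \<forall>t\<in>(\<Sum>j\<in>{k..n}. B j). bracket a t \<in> B i)"
  using assms(4,3)
proof (induction k rule: inc_induct)
  case base
  have "bracket a 0 \<in> B i" if "i \<in> {1..n}" for a i
    using subspace_0[OF subalgD(1)[OF assms(1)[OF that]]] by simp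
  then show ?case using ideal_subalg[OF ideal_zero[OF subalg_UNIV]] by (auto simp: set_zero)
next
  case (step k)
  let ?T = "\<Sum>j\<in>{Suc k..n}. B j"
  have eq: "(\<Sum>j\<in>{k..n}. B j) = B k + ?T" using step by (simp add: sum.atLeast_Suc_atMost)
  have kn: "k \<in> {1..n}" using step by auto
  have IH: "subalg ?T" "\<And>i a t. i \<in> {1..k} \<Longrightarrow> a \<in> B i \<Longrightarrow> t \<in> ?T \<Longrightarrow> bracket a t \<in> B i"
    using step.IH kn by auto
  have "subalg (B k + ?T)"
    using subalg_normalized_plus[OF assms(1)[OF kn] IH(1)] IH(2)[of k] kn by auto
  moreover have "bracket a t \<in> B i" if i: "i \<in> {1..k}" and a: "a \<in> B i" and t: "t \<in> B k + ?T" for i a t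
  proof -
    obtain b u where bu: "b \<in> B k" "u \<in> ?T" "t = b + u" using t by (auto elim!: set_plus_elim)
    have "bracket a b \<in> B i" using assms(2)[of i k] brI[OF a bu(1)] i kn by auto
    then show ?thesis
      using IH(2)[OF i a bu(2)] subspace_add[OF subalgD(1)[OF assms(1)[of i]]] i kn
      by (simp add: bu(3) bracket_add_right)
  qed
  ultimately show ?case unfolding eq by auto
qed

end

context fd_lie_algebra
begin

subsection \<open>Chains of minimal supplements\<close>

lemma small_supplement:
  assumes solv: "derived UNIV r \<subseteq> {0}" and N: "ideal_in UNIV N"
    and S: "subalg S" "UNIV \<subseteq> N + S" "N \<inter> S \<subseteq> frat_mod S {0}"
  shows "nilrad_mod S {0} = nilrad_mod UNIV N \<inter> S"
    and "frat_mod S {0} = frat_mod UNIV N \<inter> S"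
    and "chief S (nilrad_mod S {0}) (frat_mod S {0}) \<longleftrightarrow> chief UNIV (nilrad_mod UNIV N) (frat_mod UNIV N)"
proof -
  have solvS: "derived S r \<subseteq> {0}" using solv derived_mono[of S UNIV r] by blast
  show nil: "nilrad_mod S {0} = nilrad_mod UNIV N \<inter> S"
    using nilrad_mod_frattini[OF S(1) solvS ideal_Int[OF N S(1)] S(3)]
      supplement_nilrad[OF subalg_UNIV N S(1) subset_UNIV S(2)] by simp
  show frat: "frat_mod S {0} = frat_mod UNIV N \<inter> S"
    using frat_mod_absorb[OF S(3)] supplement_frat[OF subalg_UNIV N S(1) subset_UNIV S(2)] by simp
  let ?A = "nilrad_mod UNIV N" and ?B = "frat_mod UNIV N"
  have NA: "N \<subseteq> ?A" and NB: "N \<subseteq> ?B" using nilrad_contains[OF N] frat_contains by auto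
  have A: "ideal_in UNIV ?A" by (rule nilrad_ideal[OF subalg_UNIV])
  have Bs: "subspace ?B" by (rule subspace_frat[OF subalg_UNIV])
  \<comment> \<open>For chief factors the kernel is \<open>?B\<close>, not \<open>N\<close>, so
    \<open>S\<close> has to supplement \<open>?B\<close>.\<close>
  have "UNIV \<subseteq> ?B + S" using S(2) set_plus_mono2[OF NB order_refl, of S] by blast
  then have iff: "chief UNIV ?A ?B \<longleftrightarrow> chief S (?A \<inter> S) (?B \<inter> S)" if "ideal_in UNIV ?B" "?B \<subseteq> ?A"
    by (rule supplement_chief[OF subalg_UNIV that(1) S(1) subset_UNIV _ A that(2)])
  show "chief S (nilrad_mod S {0}) (frat_mod S {0}) \<longleftrightarrow> chief UNIV ?A ?B"
  proof
    assume c: "chief S (nilrad_mod S {0}) (frat_mod S {0})"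
    then have *: "ideal_in S (?B \<inter> S)" "?B \<inter> S \<subseteq> ?A" by (auto simp: chief_def nil frat)
    \<comment> \<open>\<open>iff\<close> asks for an ideal \<open>?B\<close> inside
      \<open>?A\<close>, but so far only its trace on \<open>S\<close> is under control. As
      \<open>?B\<close> contains \<open>N\<close>, it is \<open>N\<close> plus that trace.\<close>
    have "?B \<subseteq> N + ?B \<inter> S" using modular_law[OF Bs NB] S(2) by blast
    also have "\<dots> \<subseteq> ?A" by (rule plus_absorb[OF idealD(1)[OF A] NA *(2)])
    finally show "chief UNIV ?A ?B"
      using iff ideal_from_supplement[OF N S(2) subalgD(1)[OF S(1)] Bs NB *(1)] c nil frat by simp
  next
    assume c: "chief UNIV ?A ?B"
    then show "chief S (nilrad_mod S {0}) (frat_mod S {0})"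
      using iff nil frat by (auto simp: chief_def)
  qed
qed

text \<open>The chain runs through all natural numbers, so no stopping rule is needed: once
  \<open>upper_nil whole i\<close> is everything, \<open>S i\<close> lies in its own Frattini
  subalgebra and is zero.\<close>

lemma supplement_chain:
  assumes solv: "derived UNIV r \<subseteq> {0}"
  shows "\<exists>S. S 0 = UNIV \<and> (\<forall>i. subalg (S i) \<and> S (Suc i) \<subseteq> S i \<and>
    S i \<subseteq> nilrad_mod (S i) {0} + S (Suc i) \<and>
    UNIV \<subseteq> upper_nil whole i + S i \<and> upper_nil whole i \<inter> S i \<subseteq> frat_mod (S i) {0} \<and>
    nilrad_mod (S i) {0} = upper_nil whole (Suc i) \<inter> S i)"
proof -
  \<comment> \<open>The clause for \<open>i = 0\<close> pins the start of the chain in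
    \<open>dependent_nat_choice\<close>.\<close>
  let ?P = "\<lambda>(i::nat) U. subalg U \<and> (i = 0 \<longrightarrow> U = UNIV)"
  let ?Q = "\<lambda>(i::nat) U S. S \<subseteq> U \<and> U \<subseteq> nilrad_mod U {0} + S \<and> nilrad_mod U {0} \<inter> S \<subseteq> frat_mod S {0}"
  have "\<exists>U. ?P 0 U" using subalg_UNIV by blast
  moreover have "\<exists>S. ?P (Suc i) S \<and> ?Q i U S" if "?P i U" for U i
  proof -
    have U: "subalg U" using that by blast
    obtain S where "subalg S" "S \<subseteq> U" "U \<subseteq> nilrad_mod U {0} + S" "nilrad_mod U {0} \<inter> S \<subseteq> frat_mod S {0}"
      by (rule ex_min_supplement[OF U nilrad_ideal[OF U]])
    then show ?thesis by blast
  qed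
  ultimately have "\<exists>S. \<forall>i. ?P i (S i) \<and> ?Q i (S i) (S (Suc i))" by (rule dependent_nat_choice)
  then obtain S where S: "\<forall>i. ?P i (S i) \<and> ?Q i (S i) (S (Suc i))" ..
  have S0: "S 0 = UNIV" and sub: "\<And>i. subalg (S i)" using S by blast+
  have dec: "S (Suc i) \<subseteq> S i" and sup: "S i \<subseteq> nilrad_mod (S i) {0} + S (Suc i)"
    and frat: "nilrad_mod (S i) {0} \<inter> S (Suc i) \<subseteq> frat_mod (S (Suc i)) {0}" for i
    using S[rule_format, of i] by auto
  have nil: "nilrad_mod (S i) {0} = upper_nil whole (Suc i) \<inter> S i"
    if "UNIV \<subseteq> upper_nil whole i + S i" "upper_nil whole i \<inter> S i \<subseteq> frat_mod (S i) {0}" for i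
    using small_supplement(1)[OF solv upper_nil_ideal sub that] upper_nil_Suc by simp
  \<comment> \<open>The choice only controls the nilradical of \<open>S i\<close> inside
    \<open>S i\<close>. Both properties at \<open>i\<close> together identify it through
    \<open>nil\<close> with a trace of \<open>upper_nil whole (Suc i)\<close>, so they are proved
    jointly.\<close>
  have main: "UNIV \<subseteq> upper_nil whole i + S i \<and> upper_nil whole i \<inter> S i \<subseteq> frat_mod (S i) {0}" for i
  proof (induction i)
    case 0
    have "UNIV \<subseteq> {0} + S 0" using S0 by (metis subspace_UNIV subspace_single_0 subset_plus(1))
    moreover have "{0} \<subseteq> frat_mod (S 0) {0}" using frat_contains S0 by blast
    ultimately show ?case unfolding upper_nil_zero by blast
  next
    case (Suc i)
    let ?N = "upper_nil whole (Suc i)"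
    note eq = nil[OF conjunct1[OF Suc] conjunct2[OF Suc]]
    have sN: "subspace (?N + S (Suc i))"
      using subspace_plus idealD(1)[OF upper_nil_ideal] subalgD(1)[OF sub] by blast
    have N: "?N \<subseteq> ?N + S (Suc i)" "S (Suc i) \<subseteq> ?N + S (Suc i)"
      by (rule subset_plus(2)[OF subalgD(1)[OF sub]], rule subset_plus(1)[OF idealD(1)[OF upper_nil_ideal]])
    have "nilrad_mod (S i) {0} \<subseteq> ?N + S (Suc i)" using eq N(1) by blast
    then have "S i \<subseteq> ?N + S (Suc i)" using sup plus_absorb[OF sN _ N(2)] by blast
    moreover have "upper_nil whole i \<subseteq> ?N + S (Suc i)" using upper_nil_mono N(1) by blast
    ultimately have "UNIV \<subseteq> ?N + S (Suc i)" using Suc plus_absorb[OF sN] by blast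
    moreover have "?N \<inter> S (Suc i) \<subseteq> frat_mod (S (Suc i)) {0}"
      using frat[of i] eq dec[of i] by blast
    ultimately show ?case by blast
  qed
  show ?thesis
    by (intro exI[of _ S] conjI allI)
      (rule S0 sub dec sup conjunct1[OF main] conjunct2[OF main] nil[OF conjunct1[OF main] conjunct2[OF main]])+
qed

lemma upper_nil_decomposition:
  assumes S: "UNIV \<subseteq> upper_nil whole i + S"
  shows "upper_nil whole (Suc i) = upper_nil whole i + upper_nil whole (Suc i) \<inter> S"
proof
  have N: "subspace (upper_nil whole (Suc i))" using upper_nil_ideal idealD(1) by blast
  show "upper_nil whole (Suc i) \<subseteq> upper_nil whole i + upper_nil whole (Suc i) \<inter> S"
    using modular_law[OF N upper_nil_mono] S by blast
  show "upper_nil whole i + upper_nil whole (Suc i) \<inter> S \<subseteq> upper_nil whole (Suc i)"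
    by (rule plus_absorb[OF N upper_nil_mono]) blast
qed

section \<open>The two implications\<close>

text \<open>Copies the right-hand side of the theorem clause by clause, so that the last step there
  is an unfolding.\<close>

definition decomposition :: "nat \<Rightarrow> (nat \<Rightarrow> 'v set) \<Rightarrow> bool" where
  "decomposition n B \<longleftrightarrow>
     (let U = tail_sum n B in
       (\<forall>i\<in>{1..n}. lie_subalgebra whole (B i) \<and> lie_nilpotent (lie_restrict whole (B i))) \<and>
       (\<forall>i\<in>{1..n}. upper_nil whole i = (\<Sum>j\<in>{1..i}. B j)) \<and>
       lie_carrier whole = (\<Sum>j\<in>{1..n}. B j) \<and>
       (\<forall>i j. 1 \<le> i \<and> i \<le> j \<and> j \<le> n \<longrightarrow> lie_prod whole (B i) (B j) \<subseteq> B i) \<and>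
       (\<forall>i\<in>{1..n-1}.
          upper_nil whole i \<inter> U i \<subseteq> frattini (lie_restrict whole (U i)) \<and>
          frattini (lie_restrict whole (U i)) = upper_frattini whole (i + 1) \<inter> U i) \<and>
       dim (B n) = 1 \<and>
       (\<forall>k\<in>{0..n-1}.
          chief_factor (lie_restrict whole (U k))
            (nilradical (lie_restrict whole (U k))) (frattini (lie_restrict whole (U k)))))"

text \<open>Counting from 0 removes the \<open>i - 1\<close> hidden in
  \<open>upper_frattini\<close>.\<close>

lemma extreme_iff:
  "nilpotent_length whole = Suc m \<Longrightarrow> extreme whole \<longleftrightarrow>
    (\<forall>k\<le>m. chief UNIV (nilrad_mod UNIV (upper_nil whole k)) (frat_mod UNIV (upper_nil whole k)))"
proof -
  assume len: "nilpotent_length whole = Suc m"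
  have "{1..Suc m} = Suc ` {..m}" by (simp add: image_Suc_atMost)
  then have "extreme whole \<longleftrightarrow> (\<forall>k\<le>m. chief_factor whole (upper_nil whole (Suc k)) (upper_frattini whole (Suc k)))"
    unfolding extreme_def len by (auto simp del: upper_nil.simps)
  then show ?thesis
    using chief_factor_eq[OF subalg_UNIV] by (simp add: restrict_UNIV upper_nil_Suc upper_frattini_eq del: upper_nil.simps)
qed

lemma decomposition_extreme:
  assumes solv: "derived UNIV r \<subseteq> {0}" and len: "nilpotent_length whole = Suc m"
    and dec: "decomposition (Suc m) B"
  shows "extreme whole"
  unfolding extreme_iff[OF len]
proof (intro allI impI)
  fix k assume k: "k \<le> m"
  let ?U = "tail_sum (Suc m) B"
  have sub: "subalg (B i)" if "i \<in> {1..Suc m}" for i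
    using dec that unfolding decomposition_def Let_def subalgebra_eq by blast
  have nil: "upper_nil whole i = (\<Sum>j\<in>{1..i}. B j)" if "i \<in> {1..Suc m}" for i
    using dec that unfolding decomposition_def Let_def by blast
  have all: "UNIV = (\<Sum>j\<in>{1..Suc m}. B j)"
    using dec unfolding decomposition_def Let_def by (simp add: lie_of_def)
  have prod: "br (B i) (B j) \<subseteq> B i" if "1 \<le> i" "i \<le> j" "j \<le> Suc m" for i j
    using dec that unfolding decomposition_def Let_def prod_eq by blast
  have U: "subalg (?U k)"
    using subalg_tail[of "Suc m" B "k + 1"] sub prod k subalg_UNIV by (auto simp: tail_sum_def)
  have sup: "UNIV \<subseteq> upper_nil whole k + ?U k"
  proof (cases "k = 0")
    case True
    then show ?thesis using subset_plus(1)[of "{0}" UNIV] by (simp add: upper_nil_zero tail_sum_def del: upper_nil.simps)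
  next
    case False
    have "(\<Sum>j\<in>{1..Suc m}. B j) = (\<Sum>j\<in>{1..k}. B j) + (\<Sum>j\<in>{k+1..Suc m}. B j)"
      using sum.ub_add_nat[of 1 k B "Suc m - k"] k by simp
    then show ?thesis using all nil[of k] False k by (simp add: tail_sum_def del: upper_nil.simps)
  qed
  \<comment> \<open>Condition (iv) starts at index 1; at index 0 the intersection is {0}.\<close>
  have frat: "upper_nil whole k \<inter> ?U k \<subseteq> frat_mod (?U k) {0}"
  proof (cases "k = 0")
    case True
    then show ?thesis using frat_contains[of "{0}" UNIV] by (simp add: upper_nil_zero tail_sum_def del: upper_nil.simps)
  next
    case False
    then have "k \<in> {1..Suc m - 1}" using k by auto
    then have "upper_nil whole k \<inter> ?U k \<subseteq> frattini (lie_restrict whole (?U k))"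
      using dec unfolding decomposition_def Let_def by blast
    then show ?thesis by (simp only: frattini_eq[OF U])
  qed
  have "k \<in> {0..Suc m - 1}" using k by auto
  then have "chief_factor (lie_restrict whole (?U k)) (nilradical (lie_restrict whole (?U k))) (frattini (lie_restrict whole (?U k)))"
    using dec unfolding decomposition_def Let_def by blast
  then have "chief (?U k) (nilrad_mod (?U k) {0}) (frat_mod (?U k) {0})"
    by (simp only: chief_factor_eq[OF U] nilradical_eq[OF U] frattini_eq[OF U])
  then show "chief UNIV (nilrad_mod UNIV (upper_nil whole k)) (frat_mod UNIV (upper_nil whole k))"
    using small_supplement(3)[OF solv upper_nil_ideal U sup frat] by blast
qed

lemma extreme_decomposition:
  assumes solv: "derived UNIV r \<subseteq> {0}" and len: "nilpotent_length whole = Suc m"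
    and top: "upper_nil whole (Suc m) = UNIV" and ext: "extreme whole"
  shows "\<exists>B. decomposition (Suc m) B"
proof -
  obtain S where S0: "S 0 = UNIV" and sub: "\<And>i. subalg (S i)" and Sdec: "\<And>i. S (Suc i) \<subseteq> S i"
    and Ssup: "\<And>i. S i \<subseteq> nilrad_mod (S i) {0} + S (Suc i)"
    and sup: "\<And>i. UNIV \<subseteq> upper_nil whole i + S i" and frat: "\<And>i. upper_nil whole i \<inter> S i \<subseteq> frat_mod (S i) {0}"
    and nil: "\<And>i. nilrad_mod (S i) {0} = upper_nil whole (Suc i) \<inter> S i"
    using supplement_chain[OF solv] by metis
  define B where "B j = nilrad_mod (S (j - 1)) {0}" for j
  have BS: "B (Suc i) = nilrad_mod (S i) {0}" for i by (simp add: B_def)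
  have ideal: "ideal_in (S i) (B (Suc i))" for i unfolding BS by (rule nilrad_ideal[OF sub])
  have nilB: "nil_mod (B (Suc i)) {0}" for i
    unfolding BS by (rule nilrad_nil[OF sub ideal_zero[OF sub]])
  have sum: "upper_nil whole i = (\<Sum>j\<in>{1..i}. B j)" for i
  proof (induction i)
    case 0 then show ?case by (simp add: lie_of_def set_zero)
  next
    case (Suc i)
    have "upper_nil whole (Suc i) = upper_nil whole i + B (Suc i)"
      unfolding BS nil by (rule upper_nil_decomposition[OF sup])
    then show ?case using Suc by simp
  qed
  \<comment> \<open>The nilpotent length enters here: the nilradical of \<open>S m\<close> is its
    trace of the whole algebra.\<close>
  have last: "B (Suc m) = S m" unfolding BS nil top by simp
  have tail: "(\<Sum>j\<in>{Suc k..Suc m}. B j) = S k" if "k \<le> m" for k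
    using that
  proof (induction k rule: inc_induct)
    case base then show ?case using last by simp
  next
    case (step k)
    have "(\<Sum>j\<in>{Suc k..Suc m}. B j) = B (Suc k) + S (Suc k)"
      using step.hyps step.IH sum.atLeast_Suc_atMost[of "Suc k" "Suc m" B] by simp
    also have "\<dots> = S k"
      using Ssup[of k] plus_absorb[OF subalgD(1)[OF sub] idealD(2)[OF ideal] Sdec, of k] BS by auto
    finally show ?case .
  qed
  have U: "tail_sum (Suc m) B k = S k" if "k \<le> m" for k
    using tail[OF that] S0 by (auto simp: tail_sum_def)
  have anti: "S j \<subseteq> S i" if "i \<le> j" for i j
    using lift_Suc_antimono_le[of S i j] Sdec that by blast
  note small = small_supplement[OF solv upper_nil_ideal sub sup frat]
  have chief: "chief (S k) (nilrad_mod (S k) {0}) (frat_mod (S k) {0})" if "k \<le> m" for k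
    using ext that unfolding extreme_iff[OF len] small(3) by blast
  have "decomposition (Suc m) B"
    unfolding decomposition_def Let_def
  proof (intro conjI ballI allI impI)
    fix i assume "i \<in> {1..Suc m}"
    then obtain j where j: "i = Suc j" by (cases i) auto
    have Bi: "subalg (B i)" unfolding j by (rule ideal_subalg[OF ideal])
    then show "lie_subalgebra whole (B i)" by (simp only: subalgebra_eq)
    show "lie_nilpotent (lie_restrict whole (B i))"
      unfolding nilpotent_restrict_eq[OF Bi] unfolding j by (rule nilB)
    show "upper_nil whole i = (\<Sum>j\<in>{1..i}. B j)" by (rule sum)
  next
    show "lie_carrier whole = (\<Sum>j\<in>{1..Suc m}. B j)" using sum[of "Suc m"] top by (simp add: lie_of_def)
  next
    fix i j assume ij: "1 \<le> i \<and> i \<le> j \<and> j \<le> Suc m"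
    then obtain a b where ab: "i = Suc a" "j = Suc b" "a \<le> b" by (cases i; cases j) auto
    \<comment> \<open>\<open>B i\<close> is an ideal of \<open>S a\<close>, and the decreasing chain
      puts every later \<open>B j\<close> inside \<open>S a\<close>; this yields (iii).\<close>
    have "B j \<subseteq> S a" using idealD(2)[OF ideal[of b]] anti[OF ab(3)] ab(2) by blast
    then have "br (B i) (B j) \<subseteq> B i"
      using idealD'[OF ideal[of a]] idealD(1)[OF ideal[of a]] ab(1) by (intro br_subset) auto
    then show "lie_prod whole (B i) (B j) \<subseteq> B i" by (simp only: prod_eq)
  next
    fix i assume "i \<in> {1..Suc m - 1}"
    then have Ui: "tail_sum (Suc m) B i = S i" by (intro U) auto
    show "upper_nil whole i \<inter> tail_sum (Suc m) B i \<subseteq> frattini (lie_restrict whole (tail_sum (Suc m) B i))"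
      unfolding Ui frattini_eq[OF sub] by (rule frat)
    show "frattini (lie_restrict whole (tail_sum (Suc m) B i)) = upper_frattini whole (i + 1) \<inter> tail_sum (Suc m) B i"
      unfolding Ui frattini_eq[OF sub] small(2) using upper_frattini_eq by simp
  next
    show "dim (B (Suc m)) = 1"
      using nil_chief_dim[OF sub, of m] nilB[of m] chief[of m] BS[of m] last by simp
  next
    fix k assume "k \<in> {0..Suc m - 1}"
    then have k: "k \<le> m" by auto
    show "chief_factor (lie_restrict whole (tail_sum (Suc m) B k))
        (nilradical (lie_restrict whole (tail_sum (Suc m) B k))) (frattini (lie_restrict whole (tail_sum (Suc m) B k)))"
      unfolding U[OF k] chief_factor_eq[OF sub] nilradical_eq[OF sub] frattini_eq[OF sub] by (rule chief[OF k])
  qed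
  then show ?thesis by blast
qed

end

theorem theorem3p5:
  fixes scale :: "'f::field \<Rightarrow> 'v::ab_group_add \<Rightarrow> 'v"
    and bracket :: "'v \<Rightarrow> 'v \<Rightarrow> 'v"
    and L :: "('f, 'v) lie_struct"
    and n :: nat
  assumes "lie_algebra scale bracket"
    and "\<exists>Basis. finite_dimensional_vector_space scale Basis"
    and "L = lie_of scale bracket"
    and "lie_solvable L"
    and "L \<in> nilpotent_length_class n"
  shows "extreme L \<longleftrightarrow>
    (\<exists>B :: nat \<Rightarrow> 'v set.
       let U = tail_sum n B in
       (\<forall>i\<in>{1..n}. lie_subalgebra L (B i) \<and> lie_nilpotent (lie_restrict L (B i))) \<and>
       (\<forall>i\<in>{1..n}. upper_nil L i = (\<Sum>j\<in>{1..i}. B j)) \<and>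
       lie_carrier L = (\<Sum>j\<in>{1..n}. B j) \<and>
       (\<forall>i j. 1 \<le> i \<and> i \<le> j \<and> j \<le> n \<longrightarrow> lie_prod L (B i) (B j) \<subseteq> B i) \<and>
       (\<forall>i\<in>{1..n-1}.
          upper_nil L i \<inter> U i \<subseteq> frattini (lie_restrict L (U i)) \<and>
          frattini (lie_restrict L (U i)) = upper_frattini L (i + 1) \<inter> U i) \<and>
       vector_space.dim scale (B n) = 1 \<and>
       (\<forall>k\<in>{0..n-1}.
          chief_factor (lie_restrict L (U k))
            (nilradical (lie_restrict L (U k))) (frattini (lie_restrict L (U k)))))"
proof -
  obtain Basis where "finite_dimensional_vector_space scale Basis" using assms(2) by blast
  then interpret fd_lie_algebra scale bracket Basis
    using assms(1) by (simp add: fd_lie_algebra_def)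
  obtain r where r: "derived UNIV r \<subseteq> {0}" using solvable_eq assms(3,4) by blast
  have n: "1 \<le> n" "\<exists>k. upper_nil L k = lie_carrier L" "nilpotent_length L = n"
    using assms(5) by (auto simp: nilpotent_length_class_def)
  then obtain m where m: "n = Suc m" by (cases n) auto
  \<comment> \<open>Membership in the class provides some term equal to the whole algebra, so the
    \<open>LEAST\<close> is attained.\<close>
  have "upper_nil L n = lie_carrier L"
    using n(2,3) unfolding nilpotent_length_def by (metis (mono_tags, lifting) LeastI_ex)
  then have top: "upper_nil whole (Suc m) = UNIV" using m assms(3) by (simp add: lie_of_def)
  have len: "nilpotent_length whole = Suc m" using n(3) m assms(3) by simp
  have "extreme whole \<longleftrightarrow> (\<exists>B. decomposition (Suc m) B)"
    using decomposition_extreme[OF r len] extreme_decomposition[OF r len top] by blast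
  then show ?thesis unfolding assms(3) m decomposition_def .
qed

end
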